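(* Let $\mathcal{X}\subseteq\mathbb{R}^n$ and let $\mathcal{D}$ be a distribution on $\mathcal{X}\times[0,1]$ such that $\mathbb{E}[y\mid\mathbf{x}]=u(f(\mathbf{x}))$, where $u:\mathbb{R}\to[0,1]$ is a known $L$-Lipschitz non-decreasing function and $f$ is $(\epsilon,B)$-uniformly approximated by some kernel function $\mathcal{K}$ with $\mathcal{K}(\mathbf{x},\mathbf{x}')\le 1$. Then for $\delta\in(0,1)$, there exists an algorithm that draws $m$ i.i.d. samples from $\mathcal{D}$ and outputs a hypothesis $h$ such that with probability $1-\delta$, $\varepsilon(h)\le O(L\epsilon)$, for $m\ge\left(\frac{BL}{\epsilon}\right)^2\cdot\log(1/\delta)$, in time $\mathrm{poly}(n,B,L,1/\epsilon,\log(1/\delta))$.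
   Context: Kernels are assumed computable in time polynomial in the input dimension $n$. Definition: let $f:\mathcal{X}\to\mathbb{R}$ and $\mathcal{K}$ a kernel with RKHS $\mathcal{H}$ and feature map $\psi$; $f$ is $(\epsilon,B)$-uniformly approximated by $\mathcal{K}$ if there is $\mathbf{v}\in\mathcal{H}$ with $\|\mathbf{v}\|\le B$ such that $|f(\mathbf{x})-\langle\mathbf{v},\psi(\mathbf{x})\rangle|\le\epsilon$ for all $\mathbf{x}\in\mathcal{X}$. For a hypothesis $h$, $\varepsilon(h)=\mathbb{E}_{(\mathbf{x},y)\sim\mathcal{D}}[(h(\mathbf{x})-\mathbb{E}[y\mid\mathbf{x}])^2]$.
   Formalization: The constant in O(Lε) is uniform only for L ≥ L₀ > 0 and δ ≤ δ₀ < 1 and may depend on L₀ and δ₀, since an absolute constant is impossible as L → 0 or δ → 1; L = 0 (constant u) is left out. *)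

theory Defs
  imports "HOL-Probability.Probability"
begin

section \<open>Kernels and their RKHS\<close>

definition canonical_feature :: "'a set \<Rightarrow> ('a \<Rightarrow> 'a \<Rightarrow> real) \<Rightarrow> 'a \<Rightarrow> ('a \<Rightarrow> real)" where
  "canonical_feature X K x = (\<lambda>x'\<in>X. K x x')"

text \<open>The Hilbert space is given by an explicit carrier \<open>H\<close> of functions on \<open>X\<close> (extensional
  outside \<open>X\<close>) with inner product \<open>ip\<close>, so that one can quantify over kernels, domains and
  RKHSs inside a formula.\<close>

definition is_rkhs ::
  "'a set \<Rightarrow> ('a \<Rightarrow> 'a \<Rightarrow> real) \<Rightarrow> ('a \<Rightarrow> real) set \<Rightarrow> (('a \<Rightarrow> real) \<Rightarrow> ('a \<Rightarrow> real) \<Rightarrow> real) \<Rightarrow> bool"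
where
  "is_rkhs X K H ip \<longleftrightarrow>
     H \<subseteq> (X \<rightarrow>\<^sub>E UNIV) \<and>
     (\<lambda>x\<in>X. 0) \<in> H \<and>
     (\<forall>g\<in>H. \<forall>g'\<in>H. (\<lambda>x\<in>X. g x + g' x) \<in> H) \<and>
     (\<forall>c. \<forall>g\<in>H. (\<lambda>x\<in>X. c * g x) \<in> H) \<and>
     (\<forall>g\<in>H. \<forall>g'\<in>H. ip g g' = ip g' g) \<and>
     (\<forall>g\<in>H. \<forall>g'\<in>H. \<forall>k\<in>H. ip (\<lambda>x\<in>X. g x + g' x) k = ip g k + ip g' k) \<and>
     (\<forall>c. \<forall>g\<in>H. \<forall>k\<in>H. ip (\<lambda>x\<in>X. c * g x) k = c * ip g k) \<and>
     (\<forall>g\<in>H. 0 \<le> ip g g) \<and>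
     (\<forall>g\<in>H. ip g g = 0 \<longrightarrow> g = (\<lambda>x\<in>X. 0)) \<and>
     (let dst = (\<lambda>g g'. sqrt (ip (\<lambda>x\<in>X. g x - g' x) (\<lambda>x\<in>X. g x - g' x))) in
        \<forall>s :: nat \<Rightarrow> 'a \<Rightarrow> real. (\<forall>i. s i \<in> H) \<and>
           (\<forall>e>0. \<exists>N. \<forall>i\<ge>N. \<forall>j\<ge>N. dst (s i) (s j) < e) \<longrightarrow>
           (\<exists>g\<in>H. (\<lambda>i. dst (s i) g) \<longlonglongrightarrow> 0)) \<and>
     (\<forall>x\<in>X. canonical_feature X K x \<in> H \<and>
        (\<forall>g\<in>H. ip g (canonical_feature X K x) = g x))"

definition uniformly_approximated ::
  "'a set \<Rightarrow> ('a \<Rightarrow> 'a \<Rightarrow> real) \<Rightarrow> real \<Rightarrow> real \<Rightarrow> ('a \<Rightarrow> real) \<Rightarrow> bool"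
where
  "uniformly_approximated X K \<epsilon> B f \<longleftrightarrow>
     (\<exists>H ip. is_rkhs X K H ip \<and>
       (\<exists>v\<in>H. sqrt (ip v v) \<le> B \<and>
          (\<forall>x\<in>X. \<bar>f x - ip v (canonical_feature X K x)\<bar> \<le> \<epsilon>)))"


section \<open>Distributions on \<open>X \<times> [0,1]\<close> and the error of a hypothesis\<close>

text \<open>A vector of dimension \<open>n\<close> is an extensional function on \<open>{..<n}\<close>; subsets of \<open>\<real>\<^sup>n\<close>
  carry the trace of the Borel sets, so that \<open>X\<close> itself need not be measurable.\<close>

type_synonym vec = "nat \<Rightarrow> real"

definition domain_space :: "nat \<Rightarrow> vec set \<Rightarrow> vec measure" where
  "domain_space n X = restrict_space (Pi\<^sub>M {..<n} (\<lambda>_. borel)) X"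

definition distribution_on :: "nat \<Rightarrow> vec set \<Rightarrow> (vec \<times> real) measure \<Rightarrow> bool" where
  "distribution_on n X D \<longleftrightarrow>
     prob_space D \<and> sets D = sets (domain_space n X \<Otimes>\<^sub>M restrict_space borel {0..1})"

definition cond_mean :: "nat \<Rightarrow> vec set \<Rightarrow> (vec \<times> real) measure \<Rightarrow> vec \<times> real \<Rightarrow> real" where
  "cond_mean n X D = real_cond_exp D (vimage_algebra (space D) fst (domain_space n X)) snd"

text \<open>Extended-valued, so that a non-integrable squared deviation gives \<open>\<infinity>\<close> and not \<open>0\<close>.\<close>

definition err :: "nat \<Rightarrow> vec set \<Rightarrow> (vec \<times> real) measure \<Rightarrow> (vec \<Rightarrow> real) \<Rightarrow> ennreal" where
  "err n X D h = (\<integral>\<^sup>+ z. ennreal ((h (fst z) - cond_mean n X D z)\<^sup>2) \<partial>D)"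


section \<open>Algorithms: a real RAM with access to the kernel and to the link function\<close>

text \<open>Programs are finite syntactic objects with integer constants only. Real registers admit the
  four field operations and comparison at unit cost. Index registers address the memory matrix
  and can only be set to constants, copied, incremented and compared; nothing converts reals into
  indices. Row \<open>i\<close> of the memory holds a vector in its first \<open>dim\<close> columns, and the kernel
  is applied to two such rows. Besides its unit step, a kernel call costs \<open>kcost\<close>.\<close>

record oracles =
  dim :: nat
  kernel :: "vec \<Rightarrow> vec \<Rightarrow> real"
  link :: "real \<Rightarrow> real"
  kcost :: nat

record ram_state =
  idx :: "nat \<Rightarrow> nat"
  reg :: "nat \<Rightarrow> real"
  mem :: "nat \<Rightarrow> nat \<Rightarrow> real"

datatype instr =
    IConst nat nat | ICopy nat nat | IInc nat
  | RConst nat int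
  | RAdd nat nat nat | RSub nat nat nat | RMul nat nat nat | RDiv nat nat nat
  | Load nat nat nat | Store nat nat nat
  | CallKernel nat nat nat
  | CallLink nat nat

datatype test = ILess nat nat | RLess nat nat

datatype cmd =
    Skip
  | Instr instr
  | Seq cmd cmd
  | If test cmd cmd
  | While test cmd

fun step :: "oracles \<Rightarrow> instr \<Rightarrow> ram_state \<Rightarrow> ram_state" where
  "step E (IConst i k) s = s\<lparr>idx := (idx s)(i := k)\<rparr>"
| "step E (ICopy i j) s = s\<lparr>idx := (idx s)(i := idx s j)\<rparr>"
| "step E (IInc i) s = s\<lparr>idx := (idx s)(i := Suc (idx s i))\<rparr>"
| "step E (RConst r c) s = s\<lparr>reg := (reg s)(r := of_int c)\<rparr>"
| "step E (RAdd r a b) s = s\<lparr>reg := (reg s)(r := reg s a + reg s b)\<rparr>"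
| "step E (RSub r a b) s = s\<lparr>reg := (reg s)(r := reg s a - reg s b)\<rparr>"
| "step E (RMul r a b) s = s\<lparr>reg := (reg s)(r := reg s a * reg s b)\<rparr>"
| "step E (RDiv r a b) s = s\<lparr>reg := (reg s)(r := reg s a / reg s b)\<rparr>"
| "step E (Load r i j) s = s\<lparr>reg := (reg s)(r := mem s (idx s i) (idx s j))\<rparr>"
| "step E (Store i j r) s =
     s\<lparr>mem := (mem s)(idx s i := (mem s (idx s i))(idx s j := reg s r))\<rparr>"
| "step E (CallKernel r i j) s =
     s\<lparr>reg := (reg s)(r := kernel E (restrict (mem s (idx s i)) {..<dim E})
                                   (restrict (mem s (idx s j)) {..<dim E}))\<rparr>"
| "step E (CallLink r a) s = s\<lparr>reg := (reg s)(r := link E (reg s a))\<rparr>"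

fun cost :: "oracles \<Rightarrow> instr \<Rightarrow> nat" where
  "cost E (CallKernel r i j) = 1 + kcost E"
| "cost E _ = 1"

fun holds :: "test \<Rightarrow> ram_state \<Rightarrow> bool" where
  "holds (ILess i j) s \<longleftrightarrow> idx s i < idx s j"
| "holds (RLess a b) s \<longleftrightarrow> reg s a < reg s b"

text \<open>\<open>exec E c s t s'\<close>: started in \<open>s\<close>, program \<open>c\<close> halts in \<open>s'\<close> after time \<open>t\<close>.\<close>

inductive exec :: "oracles \<Rightarrow> cmd \<Rightarrow> ram_state \<Rightarrow> nat \<Rightarrow> ram_state \<Rightarrow> bool" for E where
  Skip: "exec E Skip s 1 s"
| Instr: "exec E (Instr a) s (cost E a) (step E a s)"
| Seq: "exec E c1 s1 t1 s2 \<Longrightarrow> exec E c2 s2 t2 s3 \<Longrightarrow> exec E (Seq c1 c2) s1 (t1 + t2) s3"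
| IfTrue: "holds b s \<Longrightarrow> exec E c1 s t s' \<Longrightarrow> exec E (If b c1 c2) s (1 + t) s'"
| IfFalse: "\<not> holds b s \<Longrightarrow> exec E c2 s t s' \<Longrightarrow> exec E (If b c1 c2) s (1 + t) s'"
| WhileFalse: "\<not> holds b s \<Longrightarrow> exec E (While b c) s 1 s"
| WhileTrue: "holds b s1 \<Longrightarrow> exec E c s1 t1 s2 \<Longrightarrow> exec E (While b c) s2 t2 s3 \<Longrightarrow>
    exec E (While b c) s1 (1 + t1 + t2) s3"

inductive_cases Skip_exec: "exec E Skip s t s'"
inductive_cases Instr_exec: "exec E (Instr a) s t s'"
inductive_cases Seq_exec: "exec E (Seq c1 c2) s t s'"
inductive_cases If_exec: "exec E (If b c1 c2) s t s'"
inductive_cases While_exec: "exec E (While b c) s t s'"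

lemma exec_deterministic:
  "exec E c s t s' \<Longrightarrow> exec E c s t2 s2 \<Longrightarrow> t2 = t \<and> s2 = s'"
proof (induction arbitrary: t2 s2 rule: exec.induct)
  case (Skip s)
  then show ?case by (auto elim: Skip_exec)
next
  case (Instr a s)
  then show ?case by (auto elim: Instr_exec)
next
  case Seq
  from Seq.prems show ?case by (rule Seq_exec) (metis Seq.IH)
next
  case IfTrue
  from IfTrue.prems show ?case by (rule If_exec) (simp_all add: IfTrue.hyps(1) IfTrue.IH)
next
  case IfFalse
  from IfFalse.prems show ?case by (rule If_exec) (simp_all add: IfFalse.hyps(1) IfFalse.IH)
next
  case WhileFalse
  from WhileFalse.prems show ?case by (rule While_exec) (simp_all add: WhileFalse.hyps)
next
  case (WhileTrue b s1 c t1 s' ta s3)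
  from WhileTrue.prems obtain t1' s'' ta' where "t2 = 1 + t1' + ta'"
    "exec E c s1 t1' s''" "exec E (While b c) s'' ta' s2"
    by (rule While_exec) (use WhileTrue.hyps(1) in auto)
  with WhileTrue.IH show ?case by blast
qed

text \<open>Input of the learner: \<open>n\<close>, \<open>m\<close> in index registers, \<open>B\<close>, \<open>L\<close>, \<open>\<epsilon>\<close>, \<open>\<delta>\<close> in real
  registers, and the \<open>i\<close>-th of the \<open>m\<close> labelled examples in row \<open>i\<close> (label in column \<open>n\<close>).\<close>

definition initial_state ::
  "nat \<Rightarrow> nat \<Rightarrow> real \<Rightarrow> real \<Rightarrow> real \<Rightarrow> real \<Rightarrow> (nat \<Rightarrow> vec \<times> real) \<Rightarrow> ram_state"
where
  "initial_state n m B L \<epsilon> \<delta> S =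
     \<lparr>idx = (\<lambda>_. 0)(0 := n, 1 := m),
      reg = (\<lambda>_. 0)(0 := B, 1 := L, 2 := \<epsilon>, 3 := \<delta>),
      mem = (\<lambda>i j. if i < m \<and> j < n then fst (S i) j
                   else if i < m \<and> j = n then snd (S i) else 0)\<rparr>"

definition load_query :: "nat \<Rightarrow> nat \<Rightarrow> vec \<Rightarrow> ram_state \<Rightarrow> ram_state" where
  "load_query n m x s = s\<lparr>mem := (mem s)(m := (\<lambda>j. if j < n then x j else mem s m j))\<rparr>"

text \<open>The hypothesis output by \<open>train\<close> is represented by the final machine state; its value at
  \<open>x\<close> is computed by running \<open>predict\<close> on that state after \<open>x\<close> has been written to row \<open>m\<close>.
  Both phases must respect the time bound, since otherwise the whole computation could be
  postponed to the evaluation of the hypothesis.\<close>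

definition outputs_hypothesis ::
  "oracles \<Rightarrow> cmd \<Rightarrow> cmd \<Rightarrow> nat \<Rightarrow> vec set \<Rightarrow> ram_state \<Rightarrow> real \<Rightarrow> (vec \<Rightarrow> real) \<Rightarrow> bool"
where
  "outputs_hypothesis E train predict m X s\<^sub>0 T h \<longleftrightarrow>
     (\<exists>t s. exec E train s\<^sub>0 t s \<and> real t \<le> T \<and>
       (\<forall>x\<in>X. \<exists>t' s'. exec E predict (load_query (dim E) m x s) t' s' \<and> real t' \<le> T \<and>
          h x = reg s' 0))"

definition poly_bounded :: "(nat \<Rightarrow> nat) \<Rightarrow> bool" where
  "poly_bounded \<kappa> \<longleftrightarrow> (\<exists>c d. \<forall>n. \<kappa> n \<le> c * (1 + n) ^ d)"

end

theory Submission
  imports Defs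
begin

text \<open>The learner is a single online pass of kernelised perceptron updates
  \<open>w \<mapsto> w + rate (y - u \<langle>w, \<psi> x\<rangle>) \<psi> x\<close>, each followed by an approximate projection onto a
  ball of radius of order \<open>B\<close>; every iterate is tested on a fresh example. As \<open>u\<close> is monotone and
  \<open>L\<close>-Lipschitz, the expected decrease of \<open>\<parallel>w - v\<parallel>\<^sup>2\<close> in one round is at least
  \<open>2 rate (\<epsilon>(w) / L - \<epsilon>) - rate\<^sup>2\<close>, where \<open>\<epsilon>(w)\<close> is the error of \<open>u \<langle>w, \<psi> x\<rangle>\<close>. The projection
  keeps the increments of order \<open>rate B\<close>, so by an Azuma-Hoeffding argument the total error of the
  first \<open>T\<close> iterates is \<open>O(T L \<epsilon>)\<close> as soon as \<open>T\<close> reaches \<open>(B L / \<epsilon>)\<^sup>2 log (1 / \<delta>)\<close>. The hypothesis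
  averages the predictions of the iterates, whose error is bounded by convexity of the square. Thus
  neither a validation sample nor uniform convergence is needed, and examples in excess of \<open>T\<close> can be
  ignored, which makes the running time independent of \<open>m\<close>.\<close>

section \<open>Reproducing kernel Hilbert spaces\<close>

text \<open>Two features of the claim shape the bounds. The sample size has no additive constant: it
  vanishes for \<open>B = 0\<close>, and its factor log (1 / \<delta>) tends to 0 as \<delta> tends
  to 1. Hence the average contains the zero predictor as an additional summand, which gives it a
  meaning without any round, and every bound is charged either to \<epsilon> or to (B L)^2 /
  \<epsilon>, which is at most \<epsilon> T / \<rho> for \<rho> = ln (1 / \<delta>). What results is
  L \<epsilon> + \<epsilon> (8 + 2 / \<rho>); its second part is O(L \<epsilon>) once L is bounded
  away from 0 and \<delta> away from 1. The comparison function \<open>v\<close> occurs under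
  integrals although it is an arbitrary member of an RKHS, possibly a nonseparable one. Its
  measurability is derived from that of the kernel, through the density of the span of the features.
  The machine sees kernel values only and has neither roots, logarithms nor rounding. So the norm of
  an iterate is carried along by a recurrence, and the number of rounds is found by
  counting.\<close>

locale rkhs =
  fixes X :: "'a set" and K :: "'a \<Rightarrow> 'a \<Rightarrow> real" and H :: "('a \<Rightarrow> real) set"
    and ip :: "('a \<Rightarrow> real) \<Rightarrow> ('a \<Rightarrow> real) \<Rightarrow> real"
  assumes is_rkhs: "is_rkhs X K H ip"
begin

abbreviation feature :: "'a \<Rightarrow> 'a \<Rightarrow> real" where
  "feature \<equiv> canonical_feature X K"

text \<open>The single operation g + a k stands for sums, multiples and differences at once: a set
  containing 0 and closed under it is a subspace, and two simp rules for \<open>ip\<close> expand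
  all quadratic forms that occur later.\<close>

definition comb :: "('a \<Rightarrow> real) \<Rightarrow> real \<Rightarrow> ('a \<Rightarrow> real) \<Rightarrow> 'a \<Rightarrow> real" where
  "comb g a k = (\<lambda>x\<in>X. g x + a * k x)"

abbreviation dist_sq :: "('a \<Rightarrow> real) \<Rightarrow> ('a \<Rightarrow> real) \<Rightarrow> real" where
  "dist_sq g k \<equiv> ip (comb g (-1) k) (comb g (-1) k)"

lemma zero_in: "(\<lambda>x\<in>X. 0) \<in> H"
  and scale_in: "g \<in> H \<Longrightarrow> (\<lambda>x\<in>X. c * g x) \<in> H"
  and ip_sym: "g \<in> H \<Longrightarrow> k \<in> H \<Longrightarrow> ip g k = ip k g"
  and ip_scale: "g \<in> H \<Longrightarrow> k \<in> H \<Longrightarrow> ip (\<lambda>x\<in>X. c * g x) k = c * ip g k"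
  and ip_nonneg: "g \<in> H \<Longrightarrow> 0 \<le> ip g g"
  and ip_definite: "g \<in> H \<Longrightarrow> ip g g = 0 \<Longrightarrow> g = (\<lambda>x\<in>X. 0)"
  and feature_in: "x \<in> X \<Longrightarrow> feature x \<in> H"
  and reproducing: "x \<in> X \<Longrightarrow> g \<in> H \<Longrightarrow> ip g (feature x) = g x"
  and extensional: "g \<in> H \<Longrightarrow> g \<in> X \<rightarrow>\<^sub>E UNIV"
  using is_rkhs unfolding is_rkhs_def by (blast+)

lemma add_in: "g \<in> H \<Longrightarrow> k \<in> H \<Longrightarrow> (\<lambda>x\<in>X. g x + k x) \<in> H"
  using is_rkhs unfolding is_rkhs_def by blast

lemma ip_add: "g \<in> H \<Longrightarrow> g' \<in> H \<Longrightarrow> k \<in> H \<Longrightarrow> ip (\<lambda>x\<in>X. g x + g' x) k = ip g k + ip g' k"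
  using is_rkhs unfolding is_rkhs_def by blast

lemma comb_eq_add_scale: "comb g a k = (\<lambda>x\<in>X. g x + (\<lambda>x\<in>X. a * k x) x)"
  unfolding comb_def by (rule ext) simp

lemma comb_in [simp]: "g \<in> H \<Longrightarrow> k \<in> H \<Longrightarrow> comb g a k \<in> H"
  unfolding comb_eq_add_scale by (intro add_in scale_in)

lemma comb_apply [simp]: "x \<in> X \<Longrightarrow> comb g a k x = g x + a * k x"
  by (simp add: comb_def)

lemma ip_comb_left [simp]:
  "g \<in> H \<Longrightarrow> k \<in> H \<Longrightarrow> l \<in> H \<Longrightarrow> ip (comb g a k) l = ip g l + a * ip k l"
  unfolding comb_eq_add_scale by (subst ip_add) (auto intro: scale_in simp: ip_scale)

lemma ip_comb_right [simp]:
  "g \<in> H \<Longrightarrow> k \<in> H \<Longrightarrow> l \<in> H \<Longrightarrow> ip l (comb g a k) = ip l g + a * ip l k"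
  using ip_comb_left[of g k l a] by (simp add: ip_sym[of l])

lemma complete:
  assumes "\<And>i. s i \<in> H"
    and "\<And>e. e > 0 \<Longrightarrow> \<exists>N. \<forall>i\<ge>N. \<forall>j\<ge>N. sqrt (dist_sq (s i) (s j)) < e"
  obtains g where "g \<in> H" "(\<lambda>i. sqrt (dist_sq (s i) g)) \<longlonglongrightarrow> 0"
proof -
  have comb: "(\<lambda>x\<in>X. g x - k x) = comb g (-1) k" for g k
    by (simp add: comb_def)
  have "\<forall>s :: nat \<Rightarrow> 'a \<Rightarrow> real. (\<forall>i. s i \<in> H) \<and>
           (\<forall>e>0. \<exists>N. \<forall>i\<ge>N. \<forall>j\<ge>N. sqrt (dist_sq (s i) (s j)) < e) \<longrightarrow>
           (\<exists>g\<in>H. (\<lambda>i. sqrt (dist_sq (s i) g)) \<longlonglongrightarrow> 0)"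
    using is_rkhs unfolding is_rkhs_def Let_def comb by blast
  from this[rule_format, of s] assms that show ?thesis by blast
qed

lemma cauchy_schwarz:
  assumes g: "g \<in> H" and k: "k \<in> H"
  shows "(ip g k)\<^sup>2 \<le> ip g g * ip k k"
proof (cases "ip k k = 0")
  case True
  then have "k = (\<lambda>x\<in>X. 0 * k x)"
    using ip_definite[OF k] by simp
  then have "ip k g = 0"
    using ip_scale[OF k g, of 0] by simp
  then show ?thesis using True ip_sym[OF g k] by simp
next
  case False
  then have pos: "ip k k > 0" using ip_nonneg[OF k] by simp
  define a where "a = - ip g k / ip k k"
  have "0 \<le> ip (comb g a k) (comb g a k)"
    using g k by (intro ip_nonneg) simp
  also have "\<dots> = ip g g - (ip g k)\<^sup>2 / ip k k"
    using g k pos by (simp add: a_def ip_sym[OF k g] power2_eq_square field_simps)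
  finally show ?thesis using pos by (simp add: field_simps)
qed

lemma ip_feature: "x \<in> X \<Longrightarrow> ip (feature x) (feature x) = K x x"
  by (simp add: reproducing feature_in) (simp add: canonical_feature_def)

text \<open>Cauchy-Schwarz against the feature of \<open>x\<close>. It turns norm convergence into
  pointwise convergence, and norm bounds on iterates into bounds that are uniform on
  \<open>X\<close>.\<close>

lemma eval_sq_le:
  assumes "x \<in> X" "g \<in> H"
  shows "(g x)\<^sup>2 \<le> ip g g * K x x"
  using cauchy_schwarz[OF assms(2) feature_in[OF assms(1)]] assms
  by (simp add: reproducing ip_feature)

text \<open>Minimise the distance to \<open>v\<close> over the closed subspace of functions with property \<open>P\<close>: the
  residual is orthogonal to every feature, hence zero.\<close>

lemma dense_induct:
  assumes v: "v \<in> H"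
    and zero: "P (\<lambda>x\<in>X. 0)"
    and comb: "\<And>g a k. g \<in> H \<Longrightarrow> k \<in> H \<Longrightarrow> P g \<Longrightarrow> P k \<Longrightarrow> P (comb g a k)"
    and feature: "\<And>x. x \<in> X \<Longrightarrow> P (feature x)"
    and limit: "\<And>s g. (\<And>i::nat. s i \<in> H \<and> P (s i)) \<Longrightarrow> g \<in> H \<Longrightarrow>
      (\<And>x. x \<in> X \<Longrightarrow> (\<lambda>i. s i x) \<longlonglongrightarrow> g x) \<Longrightarrow> P g"
  shows "P v"
proof -
  define M where "M = {g \<in> H. P g}"
  have M_H: "g \<in> M \<Longrightarrow> g \<in> H" for g by (simp add: M_def)
  have M_comb: "g \<in> M \<Longrightarrow> k \<in> M \<Longrightarrow> comb g a k \<in> M" for g a k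
    by (simp add: M_def comb)
  have M_zero: "(\<lambda>x\<in>X. 0) \<in> M"
    by (simp add: M_def zero_in zero)
  define d where "d = (INF g\<in>M. dist_sq v g)"
  have bdd: "bdd_below ((\<lambda>g. dist_sq v g) ` M)"
    using v M_H ip_nonneg comb_in by (intro bdd_belowI2[where m = 0]) blast
  have d_le: "d \<le> dist_sq v g" if "g \<in> M" for g
    unfolding d_def using bdd that by (rule cINF_lower)
  have "\<exists>g\<in>M. dist_sq v g < d + 1 / real (Suc i)" for i
  proof -
    have "d < d + 1 / real (Suc i)" by simp
    then show ?thesis
      unfolding d_def using cINF_less_iff[OF _ bdd, of "d + 1 / real (Suc i)"] M_zero
      by (auto simp: d_def)
  qed
  then obtain s where s: "\<And>i. s i \<in> M" "\<And>i. dist_sq v (s i) < d + 1 / real (Suc i)"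
    by metis
  \<comment> \<open>Parallelogram law: the midpoint \<open>r\<close> of \<open>p\<close> and
    \<open>q\<close> lies in \<open>M\<close> again, so its squared distance to \<open>v\<close> is
    at least \<open>d\<close>. Near minimisers are therefore near each other, and a minimising
    sequence is Cauchy.\<close>
  have close: "dist_sq p q \<le> 2 * a + 2 * b"
    if p: "p \<in> M" "dist_sq v p \<le> d + a" and q: "q \<in> M" "dist_sq v q \<le> d + b" for p q a b
  proof -
    define r where "r = comb (comb p (-1/2) p) (1/2) q"
    have "r \<in> M" unfolding r_def by (intro M_comb p q)
    from d_le[OF this] have "4 * d \<le> 4 * dist_sq v r" by simp
    also have "\<dots> = 2 * dist_sq v p + 2 * dist_sq v q - dist_sq p q"
      using v M_H[OF p(1)] M_H[OF q(1)]
      by (simp add: r_def ip_sym[of p v] ip_sym[of q v] ip_sym[of q p] algebra_simps)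
    finally show ?thesis using p(2) q(2) by argo
  qed
  have "\<exists>N. \<forall>i\<ge>N. \<forall>j\<ge>N. sqrt (dist_sq (s i) (s j)) < e" if "e > 0" for e
  proof -
    obtain N :: nat where N: "4 / e\<^sup>2 < real N"
      using reals_Archimedean2 by blast
    have "sqrt (dist_sq (s i) (s j)) < e" if ij: "i \<ge> N" "j \<ge> N" for i j
    proof -
      have small: "1 / real (Suc l) < e\<^sup>2 / 4" if "l \<ge> N" for l
      proof -
        have "4 / e\<^sup>2 < real (Suc l)" using N that by simp
        then show ?thesis using \<open>e > 0\<close> by (simp add: field_simps)
      qed
      have "dist_sq (s i) (s j) \<le> 2 * (1 / real (Suc i)) + 2 * (1 / real (Suc j))"
        using s by (intro close) (auto intro: less_imp_le)
      also have "\<dots> < e\<^sup>2"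
        using small[OF ij(1)] small[OF ij(2)] by argo
      finally show ?thesis
        using \<open>e > 0\<close> by (simp add: real_less_lsqrt)
    qed
    then show ?thesis by blast
  qed
  from complete[OF M_H[OF s(1)] this] obtain g where
    g: "g \<in> H" "(\<lambda>i. sqrt (dist_sq (s i) g)) \<longlonglongrightarrow> 0" by blast
  have pointwise: "(\<lambda>i. s i x) \<longlonglongrightarrow> g x" if x: "x \<in> X" for x
  proof -
    have bound: "\<bar>s i x - g x\<bar> \<le> sqrt (K x x) * sqrt (dist_sq (s i) g)" for i
    proof -
      have "(s i x - g x)\<^sup>2 \<le> dist_sq (s i) g * K x x"
        using eval_sq_le[OF x comb_in[OF M_H[OF s(1)] g(1)], of i "-1"] x by simp
      then have "sqrt ((s i x - g x)\<^sup>2) \<le> sqrt (K x x * dist_sq (s i) g)"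
        by (intro real_sqrt_le_mono) (simp add: mult.commute)
      then show ?thesis by (simp add: real_sqrt_mult)
    qed
    have "(\<lambda>i. sqrt (K x x) * sqrt (dist_sq (s i) g)) \<longlonglongrightarrow> 0"
      using tendsto_mult_left[OF g(2), of "sqrt (K x x)"] by simp
    then have "(\<lambda>i. s i x - g x) \<longlonglongrightarrow> 0"
      by (rule Lim_null_comparison[rotated]) (use bound in \<open>auto intro!: always_eventually\<close>)
    then show ?thesis by (simp add: LIM_zero_iff)
  qed
  have "P g"
    using limit[of s g] s(1) g(1) pointwise by (simp add: M_def)
  then have gM: "g \<in> M" using g(1) by (simp add: M_def)
  have dist_le: "dist_sq v g \<le> d"
  proof -
    \<comment> \<open>The infimum is attained at \<open>g\<close>: Cauchy-Schwarz between the
      residuals of \<open>s i\<close> and of \<open>g\<close> gives r^2 <= d r in the limit.\<close>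
    define r where "r = dist_sq v g"
    have lim: "(\<lambda>i. ip (comb v (-1) (s i)) (comb v (-1) g)) \<longlonglongrightarrow> r"
    proof -
      have "\<bar>ip (comb v (-1) (s i)) (comb v (-1) g) - r\<bar> \<le> sqrt (dist_sq (s i) g) * sqrt r" for i
      proof -
        have sH: "s i \<in> H" using M_H s by blast
        have "(ip (comb (s i) (-1) g) (comb v (-1) g))\<^sup>2 \<le> dist_sq (s i) g * r"
          unfolding r_def by (intro cauchy_schwarz comb_in sH v g)
        then have "\<bar>ip (comb (s i) (-1) g) (comb v (-1) g)\<bar> \<le> sqrt (dist_sq (s i) g) * sqrt r"
          by (metis real_sqrt_abs real_sqrt_le_mono real_sqrt_mult)
        also have "ip (comb (s i) (-1) g) (comb v (-1) g) = r - ip (comb v (-1) (s i)) (comb v (-1) g)"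
          using sH v g(1) by (simp add: r_def ip_sym[of "s i" v] ip_sym[of g v] ip_sym[of "s i" g])
        finally show ?thesis by (simp add: abs_minus_commute)
      qed
      moreover have "(\<lambda>i. sqrt (dist_sq (s i) g) * sqrt r) \<longlonglongrightarrow> 0"
        using tendsto_mult_right[OF g(2), of "sqrt r"] by simp
      ultimately have "(\<lambda>i. ip (comb v (-1) (s i)) (comb v (-1) g) - r) \<longlonglongrightarrow> 0"
        by - (rule Lim_null_comparison[rotated], assumption, simp)
      then show ?thesis by (simp add: LIM_zero_iff)
    qed
    have sq: "(\<lambda>i. (ip (comb v (-1) (s i)) (comb v (-1) g))\<^sup>2) \<longlonglongrightarrow> r\<^sup>2"
      using lim by (intro tendsto_power)
    have "(ip (comb v (-1) (s i)) (comb v (-1) g))\<^sup>2 \<le> (d + 1 / real (Suc i)) * r" for i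
    proof -
      have "(ip (comb v (-1) (s i)) (comb v (-1) g))\<^sup>2 \<le> dist_sq v (s i) * r"
        unfolding r_def by (intro cauchy_schwarz comb_in v g M_H s)
      also have "\<dots> \<le> (d + 1 / real (Suc i)) * r"
        using s(2)[of i] ip_nonneg[of "comb v (-1) g"] v g
        by (intro mult_right_mono) (auto simp: r_def intro: less_imp_le)
      finally show ?thesis .
    qed
    moreover have "(\<lambda>i. (d + 1 / real (Suc i)) * r) \<longlonglongrightarrow> (d + 0) * r"
      by (intro tendsto_mult tendsto_add tendsto_const LIMSEQ_inverse_real_of_nat[unfolded inverse_eq_divide])
    ultimately have "r\<^sup>2 \<le> (d + 0) * r"
      using sq by (intro LIMSEQ_le[of _ "r\<^sup>2"]) auto
    then have "r * r \<le> d * r" by (simp add: power2_eq_square)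
    moreover have "0 \<le> r" unfolding r_def using v g(1) by (intro ip_nonneg comb_in)
    moreover have "0 \<le> d"
      unfolding d_def using M_zero v M_H ip_nonneg comb_in by (intro cINF_greatest) blast+
    ultimately show ?thesis unfolding r_def[symmetric]
      by (cases "r = 0") (auto)
  qed
  have "v x = g x" if x: "x \<in> X" for x
  proof -
    define c where "c = v x - g x"
    have fM: "feature x \<in> M" by (simp add: M_def feature feature_in x)
    have fH: "feature x \<in> H" by (simp add: feature_in x)
    \<comment> \<open>First-order condition: \<open>g\<close> is compared with its perturbations
      along the feature of \<open>x\<close>; the linear coefficient must vanish.\<close>
    have ineq: "0 \<le> a\<^sup>2 * K x x - 2 * a * c" for a
    proof -
      have "dist_sq v g \<le> dist_sq v (comb g a (feature x))"
        using dist_le d_le[OF M_comb[OF gM fM]] by (rule order_trans)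
      also have "\<dots> = dist_sq v g - 2 * a * c + a\<^sup>2 * K x x"
        using v g(1) fH x
        by (simp add: reproducing ip_feature ip_sym[of "feature x" v] ip_sym[of "feature x" g]
            c_def power2_eq_square algebra_simps)
           (simp add: canonical_feature_def algebra_simps)
      finally show ?thesis by argo
    qed
    have K0: "K x x \<ge> 0" using ip_nonneg[OF fH] ip_feature[OF x] by simp
    have "c = 0"
    proof (rule ccontr)
      assume "c \<noteq> 0"
      \<comment> \<open>The summand 1 covers \<open>K x x = 0\<close>; this \<open>a\<close> gives
        the quadratic the negative value - a^2 (K x x + 2).\<close>
      define a where "a = c / (K x x + 1)"
      have "c = a * (K x x + 1)" using K0 by (simp add: a_def)
      then have "a\<^sup>2 * K x x - 2 * a * c = - (a\<^sup>2 * (K x x + 2))"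
        by (simp add: power2_eq_square algebra_simps)
      moreover have "a\<^sup>2 * (K x x + 2) > 0"
        using \<open>c \<noteq> 0\<close> K0 by (simp add: a_def)
      ultimately show False using ineq[of a] by simp
    qed
    then show ?thesis by (simp add: c_def)
  qed
  then have "v = g"
    using extensional[OF v] extensional[OF g(1)] by (intro PiE_ext) auto
  then show ?thesis using \<open>P g\<close> by simp
qed

end

text \<open>Measurability holds for the features and survives linear combinations and pointwise
  limits of sequences, so density carries it to all of \<open>H\<close>. It is applied to the
  comparison function, about which nothing else is known.\<close>

lemma (in rkhs) member_measurable:
  assumes v: "v \<in> H" and space: "space M = X"
    and K: "\<And>x. x \<in> X \<Longrightarrow> K x \<in> borel_measurable M"
  shows "v \<in> borel_measurable M"
proof -
  have *: "(\<lambda>x\<in>X. g x) \<in> borel_measurable M \<longleftrightarrow> g \<in> borel_measurable M" for g :: "'a \<Rightarrow> real"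
    by (rule measurable_cong) (simp add: space)
  show ?thesis
    using v
  proof (rule dense_induct)
    fix s g assume s: "\<And>i::nat. s i \<in> H \<and> s i \<in> borel_measurable M"
      and lim: "\<And>x. x \<in> X \<Longrightarrow> (\<lambda>i. s i x) \<longlonglongrightarrow> g x"
    show "g \<in> borel_measurable M"
      by (rule borel_measurable_LIMSEQ_metric[of s]) (use s lim space in auto)
  qed (auto simp: comb_def * canonical_feature_def K simp del: restrict_apply)
qed

section \<open>The online iteration\<close>

locale alphatron =
  fixes K :: "'a \<Rightarrow> 'a \<Rightarrow> real" and u :: "real \<Rightarrow> real" and rate :: real and B :: real
begin

text \<open>The second component is meant to be the squared RKHS norm of the first. By the
  reproducing property, adding b times the feature of x changes it by 2 b w(x) + b^2 K(x, x), so it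
  can be maintained from kernel values without access to the inner product.\<close>

primrec iterate :: "(nat \<Rightarrow> 'a \<times> real) \<Rightarrow> nat \<Rightarrow> ('a \<Rightarrow> real) \<times> real" where
  "iterate S 0 = (\<lambda>_. 0, 0)"
| "iterate S (Suc t) =
    (let w = fst (iterate S t); q = snd (iterate S t); x = fst (S t);
         b = rate * (snd (S t) - u (w x)); q' = q + 2 * b * w x + b\<^sup>2 * K x x;
         s = if B\<^sup>2 < q' then (1 + B\<^sup>2 / q') / 2 else 1
     in (\<lambda>x'. s * (w x' + b * K x x'), s\<^sup>2 * q'))"

definition score :: "(nat \<Rightarrow> 'a \<times> real) \<Rightarrow> nat \<Rightarrow> 'a \<Rightarrow> real" where
  "score S t = fst (iterate S t)"

definition norm_sq :: "(nat \<Rightarrow> 'a \<times> real) \<Rightarrow> nat \<Rightarrow> real" where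
  "norm_sq S t = snd (iterate S t)"

definition coef :: "(nat \<Rightarrow> 'a \<times> real) \<Rightarrow> nat \<Rightarrow> real" where
  "coef S t = rate * (snd (S t) - u (score S t (fst (S t))))"

definition moved_norm_sq :: "(nat \<Rightarrow> 'a \<times> real) \<Rightarrow> nat \<Rightarrow> real" where
  "moved_norm_sq S t = norm_sq S t + 2 * coef S t * score S t (fst (S t))
     + (coef S t)\<^sup>2 * K (fst (S t)) (fst (S t))"

text \<open>The factor \<open>(1 + B\<^sup>2 / q) / 2\<close> replaces \<open>B / sqrt q\<close>, the exact projection onto the ball of
  radius \<open>B\<close>: by AM-GM it shrinks less, and it needs no square root.\<close>

definition shrink :: "(nat \<Rightarrow> 'a \<times> real) \<Rightarrow> nat \<Rightarrow> real" where
  "shrink S t = (if B\<^sup>2 < moved_norm_sq S t then (1 + B\<^sup>2 / moved_norm_sq S t) / 2 else 1)"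

lemma score_0 [simp]: "score S 0 x = 0"
  and norm_sq_0 [simp]: "norm_sq S 0 = 0"
  by (simp_all add: score_def norm_sq_def)

lemma score_Suc:
  "score S (Suc t) x = shrink S t * (score S t x + coef S t * K (fst (S t)) x)"
  and norm_sq_Suc: "norm_sq S (Suc t) = (shrink S t)\<^sup>2 * moved_norm_sq S t"
  by (simp_all add: score_def norm_sq_def shrink_def moved_norm_sq_def coef_def Let_def)

text \<open>The additional summand \<open>u 0\<close> is the prediction of the zero function; for
  \<open>T = 0\<close> it is the whole hypothesis.\<close>

definition predictor :: "nat \<Rightarrow> (nat \<Rightarrow> 'a \<times> real) \<Rightarrow> 'a \<Rightarrow> real" where
  "predictor T S x = (u 0 + (\<Sum>t<T. u (score S t x))) / (real T + 1)"

lemma iterate_cong: "(\<And>i. i < t \<Longrightarrow> S i = S' i) \<Longrightarrow> iterate S t = iterate S' t"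
  by (induction t) (simp_all add: Let_def)

text \<open>Example \<open>t\<close> is fresh for the iterate that is tested on it. This is the
  adaptedness that the concentration bound asks for.\<close>

lemma score_cong: "(\<And>i. i < t \<Longrightarrow> S i = S' i) \<Longrightarrow> score S t = score S' t"
  using iterate_cong[of t S S'] by (simp add: score_def)

end

section \<open>Geometry of the iteration in the RKHS\<close>

locale alphatron_rkhs = rkhs X K H ip + alphatron K u rate B
  for X :: "'a set" and K H ip and u :: "real \<Rightarrow> real" and rate B +
  fixes v :: "'a \<Rightarrow> real"
  assumes K_le: "x \<in> X \<Longrightarrow> K x x \<le> 1"
    and u_range: "u r \<in> {0..1}"
    and rate: "0 \<le> rate" "rate \<le> B"
    and v: "v \<in> H" "ip v v \<le> B\<^sup>2"
begin

lemma B_nonneg: "0 \<le> B" using rate by linarith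

lemma abs_eval_le:
  assumes "x \<in> X" "g \<in> H" "ip g g \<le> r\<^sup>2" "0 \<le> r"
  shows "\<bar>g x\<bar> \<le> r"
proof -
  have "(g x)\<^sup>2 \<le> ip g g * K x x" using assms by (intro eval_sq_le)
  also have "\<dots> \<le> ip g g * 1"
    using assms K_le ip_nonneg by (intro mult_left_mono) auto
  also have "\<dots> \<le> r\<^sup>2" using assms by simp
  finally show ?thesis using assms(4) by (simp add: abs_le_square_iff[symmetric])
qed

lemma abs_ip_le:
  assumes "g \<in> H" "k \<in> H" "ip g g \<le> a\<^sup>2" "ip k k \<le> b\<^sup>2" "0 \<le> a" "0 \<le> b"
  shows "\<bar>ip g k\<bar> \<le> a * b"
proof -
  have "(ip g k)\<^sup>2 \<le> ip g g * ip k k" using assms by (intro cauchy_schwarz)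
  also have "\<dots> \<le> a\<^sup>2 * b\<^sup>2"
    using assms ip_nonneg by (intro mult_mono) auto
  finally have "(ip g k)\<^sup>2 \<le> (a * b)\<^sup>2" by (simp add: power_mult_distrib)
  then show ?thesis using assms by (simp add: abs_le_square_iff[symmetric])
qed

text \<open>Members of \<open>H\<close> are extensional on \<open>X\<close>, whereas scores are
  total functions; the restriction makes an iterate a point of \<open>H\<close>.\<close>

definition iterate_fun :: "(nat \<Rightarrow> 'a \<times> real) \<Rightarrow> nat \<Rightarrow> 'a \<Rightarrow> real" where
  "iterate_fun S t = (\<lambda>x\<in>X. score S t x)"

definition moved_fun :: "(nat \<Rightarrow> 'a \<times> real) \<Rightarrow> nat \<Rightarrow> 'a \<Rightarrow> real" where
  "moved_fun S t = comb (iterate_fun S t) (coef S t) (feature (fst (S t)))"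

lemma iterate_fun_0: "iterate_fun S 0 = (\<lambda>x\<in>X. 0)"
  by (simp add: iterate_fun_def)

lemma iterate_fun_Suc: "iterate_fun S (Suc t) = (\<lambda>x\<in>X. shrink S t * moved_fun S t x)"
  unfolding iterate_fun_def moved_fun_def
  by (rule restrict_ext) (simp add: score_Suc canonical_feature_def)

lemma abs_coef_le:
  assumes "snd (S t) \<in> {0..1}" shows "\<bar>coef S t\<bar> \<le> rate"
proof -
  have "\<bar>snd (S t) - u (score S t (fst (S t)))\<bar> \<le> 1"
    using assms u_range[of "score S t (fst (S t))"] by auto
  then show ?thesis
    using rate(1) by (simp add: coef_def abs_mult mult_left_le)
qed

text \<open>The update moves a point of norm at most 2 B by at most \<open>rate\<close>, hence by at
  most B, so the moved point has norm at most 3 B. Averaging q with B^2 as \<open>shrink\<close>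
  does then gives squared norm at most (9 + 2 + 1) B^2 / 4, which restores the invariant. Moving
  changes the squared distance to \<open>v\<close> by the linear term and at most
  \<open>rate\<close>^2; shrinking does not increase it.\<close>

lemma iterate_step:
  assumes x: "fst (S t) \<in> X" and y: "snd (S t) \<in> {0..1}"
    and w: "iterate_fun S t \<in> H" "ip (iterate_fun S t) (iterate_fun S t) = norm_sq S t"
      "norm_sq S t \<le> (2 * B)\<^sup>2"
  shows "iterate_fun S (Suc t) \<in> H"
    and "ip (iterate_fun S (Suc t)) (iterate_fun S (Suc t)) = norm_sq S (Suc t)"
    and "norm_sq S (Suc t) \<le> (2 * B)\<^sup>2"
    and "dist_sq (iterate_fun S (Suc t)) v \<le> dist_sq (iterate_fun S t) v
      + 2 * coef S t * (score S t (fst (S t)) - v (fst (S t))) + rate\<^sup>2"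
proof -
  define x where "x = fst (S t)"
  define w b q s k where "w = iterate_fun S t" and "b = coef S t" and "q = moved_norm_sq S t"
    and "s = shrink S t" and "k = moved_fun S t"
  have xX: "x \<in> X" using x by (simp add: x_def)
  have fH: "feature x \<in> H" using xX by (rule feature_in)
  have wH: "w \<in> H" using assms by (simp add: w_def)
  have wx: "w x = score S t x" using xX by (simp add: w_def iterate_fun_def)
  have k: "k = comb w b (feature x)" by (simp add: k_def moved_fun_def w_def b_def x_def)
  have kH: "k \<in> H" unfolding k by (intro comb_in wH fH)
  have ipw: "ip w w = norm_sq S t" using w by (simp add: w_def)
  have fw: "ip (feature x) w = w x" using ip_sym[OF fH wH] reproducing[OF xX wH] by simp
  have fv: "ip (feature x) v = v x" using ip_sym[OF fH v(1)] reproducing[OF xX v(1)] by simp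
  have q: "ip k k = q"
    using wH fH xX
    by (simp add: k q_def moved_norm_sq_def ipw fw wx reproducing power2_eq_square
        flip: x_def b_def) (simp add: canonical_feature_def algebra_simps)
  have b: "\<bar>b\<bar> \<le> rate" unfolding b_def using y by (rule abs_coef_le)
  have b2: "b\<^sup>2 \<le> rate\<^sup>2" using b by (metis abs_ge_zero power2_abs power_mono)
  have K0: "0 \<le> K x x" using ip_nonneg[OF fH] ip_feature[OF xX] by simp
  have bK: "b\<^sup>2 * K x x \<le> rate\<^sup>2"
    using mult_mono[OF b2 K_le[OF xX]] K0 by simp
  have q_le: "q \<le> (3 * B)\<^sup>2"
  proof -
    have "\<bar>w x\<bar> \<le> 2 * B"
      using abs_eval_le[OF xX wH, of "2 * B"] ipw w(3) B_nonneg by simp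
    then have "\<bar>b * w x\<bar> \<le> B * (2 * B)"
      unfolding abs_mult using b rate by (intro mult_mono) auto
    then have "b * w x \<le> 2 * B\<^sup>2" by (simp add: power2_eq_square abs_le_iff)
    moreover have "rate\<^sup>2 \<le> B\<^sup>2" using rate by (simp add: power_mono)
    moreover have "q = norm_sq S t + 2 * (b * w x) + b\<^sup>2 * K x x"
      by (simp add: q_def moved_norm_sq_def wx flip: x_def b_def)
    moreover have "norm_sq S t \<le> 4 * B\<^sup>2" using w(3) by (simp add: power_mult_distrib)
    ultimately have "q \<le> 9 * B\<^sup>2"
      using bK by linarith
    then show ?thesis by (simp add: power_mult_distrib)
  qed
  have q0: "0 \<le> q" using ip_nonneg[OF kH] q by simp
  have s: "s = (if B\<^sup>2 < q then (1 + B\<^sup>2 / q) / 2 else 1)"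
    by (simp add: s_def q_def shrink_def)
  have w': "iterate_fun S (Suc t) = (\<lambda>x\<in>X. s * k x)"
    by (simp add: iterate_fun_Suc s_def k_def)
  show w'H: "iterate_fun S (Suc t) \<in> H" unfolding w' by (rule scale_in[OF kH])
  have ip_w': "ip (iterate_fun S (Suc t)) l = s * ip k l" if "l \<in> H" for l
    unfolding w' using kH that by (rule ip_scale)
  have ip_w'w': "ip (iterate_fun S (Suc t)) (iterate_fun S (Suc t)) = s\<^sup>2 * q"
    using ip_w'[OF w'H] ip_w'[OF kH] ip_sym[OF kH w'H] q by (simp add: power2_eq_square)
  then show "ip (iterate_fun S (Suc t)) (iterate_fun S (Suc t)) = norm_sq S (Suc t)"
    by (simp add: norm_sq_Suc s_def q_def)
  show "norm_sq S (Suc t) \<le> (2 * B)\<^sup>2"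
  proof (cases "B\<^sup>2 < q")
    case True
    then have "q > 0" by (smt (verit) zero_le_power2)
    have "s\<^sup>2 * q = (q + B\<^sup>2)\<^sup>2 / (4 * q)"
      using True \<open>q > 0\<close> by (simp add: s power2_eq_square field_simps)
    also have "\<dots> = (q + 2 * B\<^sup>2 + B\<^sup>2 * (B\<^sup>2 / q)) / 4"
      using \<open>q > 0\<close> by (simp add: power2_eq_square field_simps)
    also have "\<dots> \<le> (9 * B\<^sup>2 + 2 * B\<^sup>2 + B\<^sup>2 * 1) / 4"
      using q_le True \<open>q > 0\<close>
      by (intro divide_right_mono add_mono mult_left_mono) (auto simp: power_mult_distrib)
    also have "\<dots> \<le> (2 * B)\<^sup>2" by (simp add: power_mult_distrib)
    finally show ?thesis by (simp add: norm_sq_Suc s_def q_def)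
  next
    case False
    then have "q \<le> 4 * B\<^sup>2" using zero_le_power2[of B] by linarith
    with False have "s\<^sup>2 * q \<le> (2 * B)\<^sup>2" using s by (simp add: power_mult_distrib)
    then show ?thesis by (simp add: norm_sq_Suc s_def q_def)
  qed
  have dist_moved: "dist_sq k v = dist_sq w v + 2 * b * (w x - v x) + b\<^sup>2 * K x x"
    using wH fH v(1) kH xX
    by (simp add: q k fw fv reproducing ip_feature ip_sym[OF v(1) wH] power2_eq_square algebra_simps)
       (simp add: canonical_feature_def algebra_simps)
  \<comment> \<open>The decrease is (1 - s) (q (1 + s) - 2 ip k v). With r the norm of
    \<open>k\<close>, \<open>ip k v\<close> is at most r B, and r > B implies 2 B <= r (1 +
    s).\<close>
  have dist_shrunk: "dist_sq (iterate_fun S (Suc t)) v \<le> dist_sq k v"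
  proof (cases "B\<^sup>2 < q")
    case True
    then have "q > 0" by (smt (verit) zero_le_power2)
    define r where "r = sqrt q"
    have r: "q = r\<^sup>2" "0 < r" using \<open>q > 0\<close> by (simp_all add: r_def)
    have "B < r" using True r B_nonneg by (simp add: power_less_imp_less_base)
    have "2 * ip k v \<le> r * (2 * B)"
      using abs_ip_le[OF kH v(1), of r B] q r v(2) B_nonneg by simp
    also have "2 * B \<le> r * (1 + s)"
    proof -
      have "r * (1 + s) - 2 * B = ((r - B)\<^sup>2 + 2 * r * (r - B)) / (2 * r)"
        using True r by (simp add: s power2_eq_square field_simps)
      also have "\<dots> \<ge> 0" using r \<open>B < r\<close> by simp
      finally show ?thesis by simp
    qed
    finally have "2 * ip k v \<le> q * (1 + s)"
      using r by (simp add: power2_eq_square mult_ac)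
    moreover have "s \<le> 1" using True \<open>q > 0\<close> by (simp add: s field_simps)
    ultimately have "0 \<le> (1 - s) * (q * (1 + s) - 2 * ip k v)" by simp
    then show ?thesis
      using w'H kH v(1) ip_w'[OF v(1)]
      by (simp add: ip_w'w' q ip_sym[OF v(1) w'H] ip_sym[OF v(1) kH] power2_eq_square algebra_simps)
  next
    case False
    then have "s = 1" by (simp add: s)
    then have "iterate_fun S (Suc t) = k"
      unfolding w' using extensional[OF kH] by (auto simp: PiE_def extensional_restrict)
    then show ?thesis by simp
  qed
  show "dist_sq (iterate_fun S (Suc t)) v \<le> dist_sq (iterate_fun S t) v
      + 2 * coef S t * (score S t (fst (S t)) - v (fst (S t))) + rate\<^sup>2"
    using dist_shrunk dist_moved bK wx by (simp add: w_def b_def x_def)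
qed

lemma iterate_invariant:
  assumes "\<And>i. i < t \<Longrightarrow> fst (S i) \<in> X \<and> snd (S i) \<in> {0..1}"
  shows "iterate_fun S t \<in> H \<and> ip (iterate_fun S t) (iterate_fun S t) = norm_sq S t \<and>
    norm_sq S t \<le> (2 * B)\<^sup>2"
  using assms
proof (induction t)
  case 0
  have "ip (\<lambda>x\<in>X. 0) (\<lambda>x\<in>X. 0) = 0"
    using ip_scale[OF zero_in zero_in, of 0] by simp
  then show ?case by (simp add: iterate_fun_0 zero_in del: restrict_apply)
next
  case (Suc t)
  have "iterate_fun S t \<in> H \<and> ip (iterate_fun S t) (iterate_fun S t) = norm_sq S t \<and>
    norm_sq S t \<le> (2 * B)\<^sup>2"
    by (rule Suc.IH) (rule Suc.prems, simp)
  then show ?case using iterate_step[of S t] Suc.prems[of t] by simp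
qed

text \<open>This uniform bound, 2 B for the iterate and B for \<open>v\<close>, is what the
  projection is for: it bounds the increments of the adapted sum by a multiple of
  \<open>rate\<close> times B.\<close>

lemma abs_score_diff_le:
  assumes "\<And>i. i < t \<Longrightarrow> fst (S i) \<in> X \<and> snd (S i) \<in> {0..1}" and x: "x \<in> X"
  shows "\<bar>score S t x - v x\<bar> \<le> 3 * B"
proof -
  have "\<bar>iterate_fun S t x\<bar> \<le> 2 * B"
    using iterate_invariant[OF assms(1)] B_nonneg by (intro abs_eval_le x) auto
  moreover have "\<bar>v x\<bar> \<le> B"
    using v B_nonneg by (intro abs_eval_le x)
  ultimately show ?thesis using x by (simp add: iterate_fun_def)
qed

text \<open>The potential argument: \<open>dist_sq\<close> to \<open>v\<close> starts at most \<open>B\<^sup>2\<close> and stays nonnegative.\<close>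

lemma potential:
  assumes "\<And>i. i < T \<Longrightarrow> fst (S i) \<in> X \<and> snd (S i) \<in> {0..1}"
  shows "0 \<le> B\<^sup>2 + (\<Sum>t<T. 2 * coef S t * (score S t (fst (S t)) - v (fst (S t)))) + real T * rate\<^sup>2"
proof -
  have "dist_sq (iterate_fun S T) v \<le>
    B\<^sup>2 + (\<Sum>t<T. 2 * coef S t * (score S t (fst (S t)) - v (fst (S t)))) + real T * rate\<^sup>2"
    using assms
  proof (induction T)
    case 0
    have "ip (\<lambda>x\<in>X. 0) l = 0" if "l \<in> H" for l
      using ip_scale[OF zero_in that, of 0] by simp
    then show ?case using v zero_in by (simp add: iterate_fun_0 ip_sym[OF v(1) zero_in] del: restrict_apply)
  next
    case (Suc T)
    have "dist_sq (iterate_fun S (Suc T)) v \<le> dist_sq (iterate_fun S T) v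
      + 2 * coef S T * (score S T (fst (S T)) - v (fst (S T))) + rate\<^sup>2"
      using iterate_invariant[of T S] Suc.prems by (intro iterate_step) auto
    with Suc.IH Suc.prems show ?case by (simp add: algebra_simps)
  qed
  moreover have "0 \<le> dist_sq (iterate_fun S T) v"
    using iterate_invariant[of T S] assms v by (intro ip_nonneg comb_in) auto
  ultimately show ?thesis by linarith
qed

end

section \<open>Concentration for adapted sums\<close>

text \<open>The last coordinate is integrated out first: by adaptedness it occurs in the last factor
  only, whose inner integral is at most 1. This is the supermartingale argument in product form;
  with values in \<open>ennreal\<close> no integrability has to be tracked.\<close>

lemma (in prob_space) nn_integral_adapted_prod_le:
  fixes F :: "nat \<Rightarrow> (nat \<Rightarrow> 'a) \<Rightarrow> 'a \<Rightarrow> ennreal"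
  assumes meas: "\<And>i. i < m \<Longrightarrow> case_prod (F i) \<in> borel_measurable (Pi\<^sub>M {..<i} (\<lambda>_. M) \<Otimes>\<^sub>M M)"
    and adapted: "\<And>i S S' z. (\<And>j. j < i \<Longrightarrow> S j = S' j) \<Longrightarrow> F i S z = F i S' z"
    and le: "\<And>i S. i < m \<Longrightarrow> S \<in> space (Pi\<^sub>M {..<i} (\<lambda>_. M)) \<Longrightarrow> (\<integral>\<^sup>+ z. F i S z \<partial>M) \<le> 1"
  shows "(\<lambda>S. \<Prod>i<m. F i S (S i)) \<in> borel_measurable (Pi\<^sub>M {..<m} (\<lambda>_. M))"
    and "(\<integral>\<^sup>+ S. (\<Prod>i<m. F i S (S i)) \<partial>Pi\<^sub>M {..<m} (\<lambda>_. M)) \<le> 1"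
proof -
  interpret product_sigma_finite "\<lambda>_. M"
    by (rule product_sigma_finite.intro) (rule sigma_finite_measure_axioms)
  have term_meas: "(\<lambda>S. F i S (S i)) \<in> borel_measurable (Pi\<^sub>M {..<k} (\<lambda>_. M))"
    if "i < k" "k \<le> m" for i k
  proof -
    have "(\<lambda>S. (restrict S {..<i}, S i)) \<in> Pi\<^sub>M {..<k} (\<lambda>_. M) \<rightarrow>\<^sub>M Pi\<^sub>M {..<i} (\<lambda>_. M) \<Otimes>\<^sub>M M"
      using that by (intro measurable_Pair measurable_restrict_subset measurable_component_singleton) auto
    then have "(\<lambda>S. case_prod (F i) (restrict S {..<i}, S i)) \<in> borel_measurable (Pi\<^sub>M {..<k} (\<lambda>_. M))"
      by (rule measurable_compose[OF _ meas]) (use that in simp)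
    moreover have "case_prod (F i) (restrict S {..<i}, S i) = F i S (S i)" for S
      by (simp, rule adapted) simp
    ultimately show ?thesis by simp
  qed
  have prod_meas: "(\<lambda>S. \<Prod>i<k. F i S (S i)) \<in> borel_measurable (Pi\<^sub>M {..<k} (\<lambda>_. M))" if "k \<le> m" for k
    using that by (intro borel_measurable_prod_ennreal term_meas) auto
  then show "(\<lambda>S. \<Prod>i<m. F i S (S i)) \<in> borel_measurable (Pi\<^sub>M {..<m} (\<lambda>_. M))" by simp
  have "(\<integral>\<^sup>+ S. (\<Prod>i<k. F i S (S i)) \<partial>Pi\<^sub>M {..<k} (\<lambda>_. M)) \<le> 1" if "k \<le> m" for k
    using that
  proof (induction k)
    case 0
    show ?case by (simp add: space_PiM_empty nn_integral_count_space_finite PiM_empty)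
  next
    case (Suc k)
    have "(\<integral>\<^sup>+ S. (\<Prod>i<Suc k. F i S (S i)) \<partial>Pi\<^sub>M {..<Suc k} (\<lambda>_. M)) =
      (\<integral>\<^sup>+ S. (\<integral>\<^sup>+ z. (\<Prod>i<Suc k. F i (S(k := z)) ((S(k := z)) i)) \<partial>M) \<partial>Pi\<^sub>M {..<k} (\<lambda>_. M))"
      using prod_meas[OF Suc.prems] unfolding lessThan_Suc
      by (subst product_nn_integral_insert) auto
    also have "\<dots> = (\<integral>\<^sup>+ S. (\<integral>\<^sup>+ z. (\<Prod>i<k. F i S (S i)) * F k S z \<partial>M) \<partial>Pi\<^sub>M {..<k} (\<lambda>_. M))"
    proof (intro nn_integral_cong)
      fix S z
      have "F i (S(k := z)) = F i S" if "i \<le> k" for i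
        using that by (intro ext adapted) simp
      then show "(\<Prod>i<Suc k. F i (S(k := z)) ((S(k := z)) i)) = (\<Prod>i<k. F i S (S i)) * F k S z"
        by simp
    qed
    also have "\<dots> = (\<integral>\<^sup>+ S. (\<Prod>i<k. F i S (S i)) * (\<integral>\<^sup>+ z. F k S z \<partial>M) \<partial>Pi\<^sub>M {..<k} (\<lambda>_. M))"
    proof (intro nn_integral_cong nn_integral_cmult)
      fix S assume "S \<in> space (Pi\<^sub>M {..<k} (\<lambda>_. M))"
      then show "F k S \<in> borel_measurable M"
        using measurable_Pair2[OF meas, of k S] Suc.prems by simp
    qed
    also have "\<dots> \<le> (\<integral>\<^sup>+ S. (\<Prod>i<k. F i S (S i)) * 1 \<partial>Pi\<^sub>M {..<k} (\<lambda>_. M))"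
      using Suc.prems by (intro nn_integral_mono mult_left_mono le) auto
    also have "\<dots> \<le> 1" using Suc by simp
    finally show ?case .
  qed
  then show "(\<integral>\<^sup>+ S. (\<Prod>i<m. F i S (S i)) \<partial>Pi\<^sub>M {..<m} (\<lambda>_. M)) \<le> 1" by simp
qed

text \<open>The Chernoff bound behind the Azuma-Hoeffding inequality; the parameter \<open>l\<close> is left free.\<close>

lemma (in prob_space) adapted_sum_tail:
  fixes G :: "nat \<Rightarrow> (nat \<Rightarrow> 'a) \<Rightarrow> 'a \<Rightarrow> real"
  assumes "T \<le> m" "0 < l"
    and meas: "\<And>i. i < T \<Longrightarrow> case_prod (G i) \<in> borel_measurable (Pi\<^sub>M {..<i} (\<lambda>_. M) \<Otimes>\<^sub>M M)"
    and adapted: "\<And>i S S' z. (\<And>j. j < i \<Longrightarrow> S j = S' j) \<Longrightarrow> G i S z = G i S' z"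
    and bound: "\<And>i S z. i < T \<Longrightarrow> S \<in> space (Pi\<^sub>M {..<i} (\<lambda>_. M)) \<Longrightarrow> z \<in> space M \<Longrightarrow> \<bar>G i S z\<bar> \<le> A"
  defines "P \<equiv> Pi\<^sub>M {..<m} (\<lambda>_. M)"
    and "dev \<equiv> (\<lambda>S. \<Sum>i<T. G i S (S i) - (\<integral>z. G i S z \<partial>M))"
  shows "dev \<in> borel_measurable P"
    and "measure P {S \<in> space P. a \<le> dev S} \<le> exp (real T * l\<^sup>2 * A\<^sup>2 / 2 - l * a)"
proof -
  define mean where "mean i S = (\<integral>z. G i S z \<partial>M)" for i S
  \<comment> \<open>The exponential of the centred increment, divided by its Hoeffding bound for an
    interval of length 2 A, since l^2 (2 A)^2 / 8 = l^2 A^2 / 2. Rounds from \<open>T\<close> on get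
    the factor 1, so the product can run over all \<open>m\<close> coordinates.\<close>
  define F where "F i S z =
    (if i < T then ennreal (exp (l * (G i S z - mean i S) - l\<^sup>2 * A\<^sup>2 / 2)) else 1)" for i S z
  have mean_cong: "mean i S = mean i S'" if "\<And>j. j < i \<Longrightarrow> S j = S' j" for i S S'
    unfolding mean_def by (intro Bochner_Integration.integral_cong refl adapted that)
  have mean_meas: "mean i \<in> borel_measurable (Pi\<^sub>M {..<i} (\<lambda>_. M))" if "i < T" for i
    unfolding mean_def using meas[OF that] by (intro borel_measurable_lebesgue_integral)
  have pair_meas: "case_prod (\<lambda>S z. G i S z - mean i S) \<in> borel_measurable (Pi\<^sub>M {..<i} (\<lambda>_. M) \<Otimes>\<^sub>M M)"
    if "i < T" for i
    using meas[OF that] measurable_compose[OF measurable_fst mean_meas[OF that]]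
    by (auto simp: case_prod_unfold intro!: borel_measurable_diff)
  have F_meas: "case_prod (F i) \<in> borel_measurable (Pi\<^sub>M {..<i} (\<lambda>_. M) \<Otimes>\<^sub>M M)" for i
  proof (cases "i < T")
    case True
    note [measurable] = pair_meas[OF True]
    have "(\<lambda>p. ennreal (exp (l * (case_prod (\<lambda>S z. G i S z - mean i S) p) - l\<^sup>2 * A\<^sup>2 / 2)))
      \<in> borel_measurable (Pi\<^sub>M {..<i} (\<lambda>_. M) \<Otimes>\<^sub>M M)"
      by measurable
    then show ?thesis using True by (simp add: F_def case_prod_unfold)
  qed (simp add: F_def case_prod_unfold)
  have F_adapted: "F i S z = F i S' z" if "\<And>j. j < i \<Longrightarrow> S j = S' j" for i S S' z
  proof -
    have "G i S z = G i S' z" "mean i S = mean i S'"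
      by (rule adapted mean_cong, erule that)+
    then show ?thesis by (simp add: F_def)
  qed
  have F_le: "(\<integral>\<^sup>+ z. F i S z \<partial>M) \<le> 1" if S: "S \<in> space (Pi\<^sub>M {..<i} (\<lambda>_. M))" for i S
  proof (cases "i < T")
    case True
    have "G i S \<in> borel_measurable M"
      using measurable_Pair2[OF meas[OF True] S] by simp
    then interpret interval_bounded_random_variable M "G i S" "- A" A
      by unfold_locales (use bound[OF True S] in \<open>auto intro!: AE_I2 simp: abs_le_iff minus_le_iff\<close>)
    have "(\<integral>\<^sup>+ z. ennreal (exp (l * (G i S z - mean i S))) \<partial>M) \<le> ennreal (exp (l\<^sup>2 * (A - - A)\<^sup>2 / 8))"
      using Hoeffdings_lemma_nn_integral[OF \<open>0 < l\<close>] by (simp add: mean_def)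
    also have "l\<^sup>2 * (A - - A)\<^sup>2 / 8 = l\<^sup>2 * A\<^sup>2 / 2" by (simp add: power2_eq_square)
    finally have *: "(\<integral>\<^sup>+ z. ennreal (exp (l * (G i S z - mean i S))) \<partial>M) \<le> ennreal (exp (l\<^sup>2 * A\<^sup>2 / 2))" .
    have "(\<integral>\<^sup>+ z. F i S z \<partial>M) =
      (\<integral>\<^sup>+ z. ennreal (exp (- (l\<^sup>2 * A\<^sup>2 / 2))) * ennreal (exp (l * (G i S z - mean i S))) \<partial>M)"
      using True by (intro nn_integral_cong) (simp add: F_def algebra_simps flip: ennreal_mult' exp_add)
    also have "\<dots> = ennreal (exp (- (l\<^sup>2 * A\<^sup>2 / 2))) * (\<integral>\<^sup>+ z. ennreal (exp (l * (G i S z - mean i S))) \<partial>M)"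
      by (rule nn_integral_cmult) simp
    also have "\<dots> \<le> ennreal (exp (- (l\<^sup>2 * A\<^sup>2 / 2))) * ennreal (exp (l\<^sup>2 * A\<^sup>2 / 2))"
      using * by (rule mult_left_mono) simp
    also have "\<dots> = 1" by (simp flip: ennreal_mult' exp_add)
    finally show ?thesis .
  qed (simp add: F_def emeasure_space_1)
  have dev: "dev S = (\<Sum>i<T. G i S (S i) - mean i S)" for S
    by (simp add: dev_def mean_def)
  show dev_meas: "dev \<in> borel_measurable P"
  proof -
    have "(\<lambda>S. G i S (S i) - mean i S) \<in> borel_measurable P" if "i < T" for i
    proof -
      have "(\<lambda>S. (restrict S {..<i}, S i)) \<in> P \<rightarrow>\<^sub>M Pi\<^sub>M {..<i} (\<lambda>_. M) \<Otimes>\<^sub>M M"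
        unfolding P_def using that \<open>T \<le> m\<close>
        by (intro measurable_Pair measurable_restrict_subset measurable_component_singleton) auto
      from measurable_compose[OF this pair_meas[OF that]]
      have "(\<lambda>S. G i (restrict S {..<i}) (S i) - mean i (restrict S {..<i})) \<in> borel_measurable P"
        by simp
      moreover have "G i (restrict S {..<i}) (S i) = G i S (S i)" for S
        by (rule adapted) simp
      moreover have "mean i (restrict S {..<i}) = mean i S" for S
        by (rule mean_cong) simp
      ultimately show ?thesis by simp
    qed
    then show ?thesis unfolding dev[abs_def] by (intro borel_measurable_sum) simp
  qed
  define c where "c = exp (real T * l\<^sup>2 * A\<^sup>2 / 2 - l * a)"
  have prod: "(\<Prod>i<m. F i S (S i)) = ennreal (exp (l * dev S - real T * l\<^sup>2 * A\<^sup>2 / 2))" for S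
  proof -
    have "(\<Prod>i<m. F i S (S i)) = (\<Prod>i<T. F i S (S i))"
      using \<open>T \<le> m\<close> by (intro prod.mono_neutral_right) (auto simp: F_def)
    also have "\<dots> = (\<Prod>i<T. ennreal (exp (l * (G i S (S i) - mean i S) - l\<^sup>2 * A\<^sup>2 / 2)))"
      by (intro prod.cong) (simp_all add: F_def)
    also have "\<dots> = ennreal (exp (l * dev S - real T * l\<^sup>2 * A\<^sup>2 / 2))"
      by (simp add: prod_ennreal dev sum_subtractf sum_distrib_left right_diff_distrib mult.assoc flip: exp_sum)
    finally show ?thesis .
  qed
  have prod_meas: "(\<lambda>S. \<Prod>i<m. F i S (S i)) \<in> borel_measurable P"
    unfolding P_def by (rule nn_integral_adapted_prod_le(1); (rule F_meas F_adapted F_le; blast))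
  have prod_le: "(\<integral>\<^sup>+ S. (\<Prod>i<m. F i S (S i)) \<partial>P) \<le> 1"
    unfolding P_def by (rule nn_integral_adapted_prod_le(2); (rule F_meas F_adapted F_le; blast))
  interpret P: prob_space P unfolding P_def by (intro prob_space_PiM) (rule prob_space_axioms)
  have "emeasure P {S \<in> space P. a \<le> dev S} \<le>
    emeasure P {S \<in> space P. 1 \<le> ennreal c * (\<Prod>i<m. F i S (S i))}"
  proof (rule emeasure_mono)
    show "{S \<in> space P. a \<le> dev S} \<subseteq> {S \<in> space P. 1 \<le> ennreal c * (\<Prod>i<m. F i S (S i))}"
    proof clarsimp
      fix S assume "a \<le> dev S"
      then have "1 \<le> exp (l * (dev S - a))" using \<open>0 < l\<close> by simp
      also have "\<dots> = c * exp (l * dev S - real T * l\<^sup>2 * A\<^sup>2 / 2)"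
        by (simp add: c_def algebra_simps flip: exp_add)
      finally show "1 \<le> ennreal c * (\<Prod>i<m. F i S (S i))"
        unfolding prod by (simp add: c_def flip: ennreal_mult')
    qed
    show "{S \<in> space P. 1 \<le> ennreal c * (\<Prod>i<m. F i S (S i))} \<in> sets P"
      unfolding prod using dev_meas by measurable
  qed
  also have "\<dots> \<le> ennreal c * (\<integral>\<^sup>+ S. (\<Prod>i<m. F i S (S i)) * indicator (space P) S \<partial>P)"
    using prod_meas by (intro nn_integral_Markov_inequality) auto
  also have "(\<integral>\<^sup>+ S. (\<Prod>i<m. F i S (S i)) * indicator (space P) S \<partial>P) =
      (\<integral>\<^sup>+ S. (\<Prod>i<m. F i S (S i)) \<partial>P)"
    by (intro nn_integral_cong) simp
  also have "ennreal c * (\<integral>\<^sup>+ S. (\<Prod>i<m. F i S (S i)) \<partial>P) \<le> ennreal c * 1"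
    using prod_le by (intro mult_left_mono) simp_all
  finally have "emeasure P {S \<in> space P. a \<le> dev S} \<le> ennreal c" by simp
  then show "measure P {S \<in> space P. a \<le> dev S} \<le> exp (real T * l\<^sup>2 * A\<^sup>2 / 2 - l * a)"
    by (simp add: c_def P.emeasure_eq_measure)
qed

section \<open>Error of the averaged predictor\<close>

locale alphatron_learning = alphatron_rkhs X K H ip u rate B v
  for X :: "vec set" and K H ip u rate B v +
  fixes n :: nat and D :: "(vec \<times> real) measure" and f :: "vec \<Rightarrow> real" and L \<epsilon> :: real
  assumes X_sub: "X \<subseteq> ({..<n} \<rightarrow>\<^sub>E UNIV)"
    and distribution: "distribution_on n X D"
    and cond_mean: "AE z in D. cond_mean n X D z = u (f (fst z))"
    and lipschitz: "L-lipschitz_on UNIV u"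
    and mono: "mono u"
    and approx: "x \<in> X \<Longrightarrow> \<bar>f x - v x\<bar> \<le> \<epsilon>"
    and K_meas: "case_prod K \<in> borel_measurable (domain_space n X \<Otimes>\<^sub>M domain_space n X)"
    and L_pos: "0 < L"
begin

abbreviation XM :: "vec measure" where "XM \<equiv> domain_space n X"
abbreviation cm :: "vec \<times> real \<Rightarrow> real" where "cm \<equiv> Defs.cond_mean n X D"

lemma space_XM: "space XM = X"
  using X_sub by (auto simp: domain_space_def space_restrict_space space_PiM)

sublocale D: prob_space D
  using distribution by (simp add: distribution_on_def)

lemma sets_D: "sets D = sets (XM \<Otimes>\<^sub>M restrict_space borel {0..1})"
  using distribution by (simp add: distribution_on_def)

lemma space_D: "space D = X \<times> {0..1}"
  using sets_eq_imp_space_eq[OF sets_D] by (simp add: space_pair_measure space_XM space_restrict_space)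

lemma fst_meas [measurable]: "fst \<in> D \<rightarrow>\<^sub>M XM"
  using measurable_fst by (simp add: measurable_cong_sets[OF sets_D refl])

lemma snd_meas [measurable]: "snd \<in> borel_measurable D"
proof -
  have "snd \<in> XM \<Otimes>\<^sub>M restrict_space borel {0..1} \<rightarrow>\<^sub>M restrict_space borel {0..1::real}"
    by (rule measurable_snd)
  then have "snd \<in> XM \<Otimes>\<^sub>M restrict_space borel {0..1::real} \<rightarrow>\<^sub>M borel"
    by (simp add: measurable_restrict_space2_iff)
  then show ?thesis by (simp add: measurable_cong_sets[OF sets_D refl])
qed

lemma u_meas [measurable]: "u \<in> borel_measurable borel"
  using mono by (rule borel_measurable_mono)

lemma v_meas [measurable]: "v \<in> borel_measurable XM"
proof (rule member_measurable[OF v(1) space_XM])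
  fix x assume "x \<in> X"
  then show "K x \<in> borel_measurable XM"
    using measurable_Pair2[OF K_meas, of x] by (simp add: space_XM)
qed

abbreviation XF :: "(vec \<times> real) measure" where
  "XF \<equiv> vimage_algebra (space D) fst XM"

lemma subalgebra_XF: "subalgebra D XF"
proof -
  have "sets XF \<subseteq> sets D"
    using measurable_sets[OF fst_meas] by (subst sets_vimage_algebra2) (auto simp: space_XM space_D)
  then show ?thesis by (simp add: subalgebra_def)
qed

sublocale XF: finite_measure_subalgebra D XF
  by unfold_locales (rule subalgebra_XF)

lemma cm_meas [measurable]: "cm \<in> borel_measurable D"
  by (simp add: cond_mean_def)

lemma cm_range: "AE z in D. cm z \<in> {0..1}"
  using cond_mean by eventually_elim (use u_range in simp)

text \<open>The defining property of conditional expectation, as \<open>g\<close> composed with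
  \<open>fst\<close> is bounded and measurable for the sigma-algebra generated by the first
  coordinate. It removes the noise of the label from the expected drift.\<close>

lemma integral_label:
  assumes g [measurable]: "g \<in> borel_measurable XM" and bound: "\<And>x. x \<in> X \<Longrightarrow> \<bar>g x\<bar> \<le> c"
  shows "(\<integral>z. g (fst z) * snd z \<partial>D) = (\<integral>z. g (fst z) * cm z \<partial>D)"
proof -
  have "integrable D (\<lambda>z. g (fst z) * snd z)"
  proof (rule D.integrable_const_bound[where B = c])
    show "AE z in D. norm (g (fst z) * snd z) \<le> c"
    proof (rule AE_I2)
      fix z assume "z \<in> space D"
      then have "\<bar>g (fst z)\<bar> \<le> c" "\<bar>snd z\<bar> \<le> 1" using bound by (auto simp: space_D)
      then show "norm (g (fst z) * snd z) \<le> c"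
        unfolding real_norm_def abs_mult using mult_mono[of "\<bar>g (fst z)\<bar>" c "\<bar>snd z\<bar>" 1] by simp
    qed
  qed simp
  moreover have "(\<lambda>z. g (fst z)) \<in> borel_measurable XF"
    by (rule measurable_compose[OF measurable_vimage_algebra1 g]) (auto simp: space_D space_XM)
  ultimately show ?thesis
    using XF.real_cond_exp_intg(2)[of "\<lambda>z. g (fst z)" snd] by (simp add: cond_mean_def)
qed

text \<open>The linear term in the one-step change of the squared distance to \<open>v\<close>, as a
  function of the fresh example \<open>z\<close>.\<close>

definition drift :: "(vec \<Rightarrow> real) \<Rightarrow> vec \<times> real \<Rightarrow> real" where
  "drift w z = 2 * (rate * (snd z - u (w (fst z)))) * (w (fst z) - v (fst z))"

definition risk :: "(vec \<Rightarrow> real) \<Rightarrow> real" where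
  "risk w = (\<integral>z. (u (w (fst z)) - cm z)\<^sup>2 \<partial>D)"

lemma integrable_risk:
  assumes [measurable]: "w \<in> borel_measurable XM"
  shows "integrable D (\<lambda>z. (u (w (fst z)) - cm z)\<^sup>2)"
proof (rule D.integrable_const_bound[where B = 1])
  show "AE z in D. norm ((u (w (fst z)) - cm z)\<^sup>2) \<le> 1"
    using cm_range
  proof eventually_elim
    case (elim z)
    then have "\<bar>u (w (fst z)) - cm z\<bar> \<le> 1" using u_range[of "w (fst z)"] by auto
    then show ?case by (simp add: abs_square_le_1)
  qed
qed simp

lemma abs_drift_le:
  assumes "\<bar>w (fst z) - v (fst z)\<bar> \<le> 3 * B" "z \<in> space D"
  shows "\<bar>drift w z\<bar> \<le> 6 * rate * B"
proof -
  have "\<bar>snd z - u (w (fst z))\<bar> \<le> 1"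
    using assms(2) u_range[of "w (fst z)"] by (auto simp: space_D)
  then have "\<bar>snd z - u (w (fst z))\<bar> * \<bar>w (fst z) - v (fst z)\<bar> \<le> 1 * (3 * B)"
    using assms(1) by (intro mult_mono) auto
  then have "2 * rate * (\<bar>snd z - u (w (fst z))\<bar> * \<bar>w (fst z) - v (fst z)\<bar>) \<le> 2 * rate * (1 * (3 * B))"
    using rate by (intro mult_left_mono) auto
  moreover have "drift w z = 2 * rate * ((snd z - u (w (fst z))) * (w (fst z) - v (fst z)))"
    by (simp add: drift_def)
  ultimately show ?thesis using rate by (simp only: abs_mult)
qed

text \<open>This is what makes the perceptron update, which ignores the derivative of \<open>u\<close>, a descent
  direction.\<close>

lemma monotone_lipschitz: "(u a - u b)\<^sup>2 \<le> L * ((u a - u b) * (a - b))"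
proof (induction a b rule: linorder_wlog)
  case (le a b)
  have "u a \<le> u b" using mono le by (rule monoD)
  moreover have "\<bar>u a - u b\<bar> \<le> L * \<bar>a - b\<bar>"
    using lipschitz_onD[OF lipschitz, of a b] by (simp add: dist_real_def)
  ultimately have "(u b - u a) * (u b - u a) \<le> (u b - u a) * (L * (b - a))"
    using le by (intro mult_left_mono) auto
  then show ?case by (simp add: power2_eq_square algebra_simps)
next
  case (sym a b)
  then show ?case by (simp add: power2_eq_square algebra_simps)
qed

text \<open>Once the label is replaced by its conditional mean, the integrand is - 2 rate d (w - v)
  with d = u(w) - u(f). Splitting w - v into (w - f) + (f - v), the first part yields d^2 / L by
  \<open>monotone_lipschitz\<close>, and the second costs at most \<epsilon> since d has modulus at
  most 1.\<close>

lemma expected_drift_le: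
  assumes w [measurable]: "w \<in> borel_measurable XM" and close: "\<And>x. x \<in> X \<Longrightarrow> \<bar>w x - v x\<bar> \<le> 3 * B"
  shows "(\<integral>z. drift w z \<partial>D) \<le> 2 * rate * \<epsilon> - 2 * rate / L * risk w"
proof -
  define g where "g x = 2 * rate * (w x - v x)" for x
  have g_meas [measurable]: "g \<in> borel_measurable XM" unfolding g_def by simp
  have g_bound: "\<bar>g x\<bar> \<le> 6 * rate * B" if "x \<in> X" for x
  proof -
    have "2 * rate * \<bar>w x - v x\<bar> \<le> 2 * rate * (3 * B)"
      using rate close[OF that] by (intro mult_left_mono) auto
    then show ?thesis using rate by (simp add: g_def abs_mult)
  qed
  have int: "integrable D (\<lambda>z. g (fst z) * r z)"
    if [measurable]: "r \<in> borel_measurable D" and r: "AE z in D. r z \<in> {0..1}" for r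
  proof (rule D.integrable_const_bound[where B = "6 * rate * B"])
    show "AE z in D. norm (g (fst z) * r z) \<le> 6 * rate * B"
      using r AE_space
    proof eventually_elim
      case (elim z)
      then have "\<bar>g (fst z)\<bar> \<le> 6 * rate * B" using g_bound by (auto simp: space_D)
      moreover have "\<bar>r z\<bar> \<le> 1" using elim by auto
      ultimately show ?case
        unfolding real_norm_def abs_mult
        using mult_mono[of "\<bar>g (fst z)\<bar>" "6 * rate * B" "\<bar>r z\<bar>" 1] rate B_nonneg by simp
    qed
  qed simp
  have int_snd: "integrable D (\<lambda>z. g (fst z) * snd z)"
    by (rule int) (auto simp: space_D intro!: AE_I2)
  have int_cm: "integrable D (\<lambda>z. g (fst z) * cm z)"
    by (rule int[OF cm_meas cm_range])
  have int_u: "integrable D (\<lambda>z. g (fst z) * u (w (fst z)))"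
    using u_range by (intro int) auto
  have "(\<integral>z. drift w z \<partial>D) = (\<integral>z. g (fst z) * snd z - g (fst z) * u (w (fst z)) \<partial>D)"
    by (intro Bochner_Integration.integral_cong) (simp_all add: drift_def g_def algebra_simps)
  also have "\<dots> = (\<integral>z. g (fst z) * snd z \<partial>D) - (\<integral>z. g (fst z) * u (w (fst z)) \<partial>D)"
    using int_snd int_u by (rule Bochner_Integration.integral_diff)
  also have "(\<integral>z. g (fst z) * snd z \<partial>D) = (\<integral>z. g (fst z) * cm z \<partial>D)"
    using g_bound by (intro integral_label) auto
  also have "\<dots> - (\<integral>z. g (fst z) * u (w (fst z)) \<partial>D) =
      (\<integral>z. g (fst z) * cm z - g (fst z) * u (w (fst z)) \<partial>D)"
    using int_cm int_u by (rule Bochner_Integration.integral_diff[symmetric])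
  also have "\<dots> \<le> (\<integral>z. 2 * rate * \<epsilon> - 2 * rate / L * (u (w (fst z)) - cm z)\<^sup>2 \<partial>D)"
  proof (rule integral_mono_AE)
    show "integrable D (\<lambda>z. 2 * rate * \<epsilon> - 2 * rate / L * (u (w (fst z)) - cm z)\<^sup>2)"
      using integrable_risk[OF w] by simp
    show "AE z in D. g (fst z) * cm z - g (fst z) * u (w (fst z)) \<le>
        2 * rate * \<epsilon> - 2 * rate / L * (u (w (fst z)) - cm z)\<^sup>2"
      using cond_mean AE_space
    proof eventually_elim
      case (elim z)
      define x where "x = fst z"
      have x: "x \<in> X" using elim by (auto simp: space_D x_def)
      define d where "d = u (w x) - u (f x)"
      have "d\<^sup>2 / L \<le> d * (w x - f x)"
        using monotone_lipschitz[of "w x" "f x"] L_pos by (simp add: d_def field_simps)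
      moreover have "- (d * (f x - v x)) \<le> \<epsilon>"
      proof -
        have "\<bar>d\<bar> \<le> 1" using u_range[of "w x"] u_range[of "f x"] by (auto simp: d_def)
        then have "\<bar>d\<bar> * \<bar>f x - v x\<bar> \<le> 1 * \<epsilon>" using approx[OF x] by (intro mult_mono) auto
        then have "\<bar>d * (f x - v x)\<bar> \<le> \<epsilon>" by (simp add: abs_mult)
        then show ?thesis by linarith
      qed
      moreover have "d * (w x - v x) = d * (w x - f x) + d * (f x - v x)"
        by (simp add: algebra_simps)
      ultimately have "- (d * (w x - v x)) \<le> \<epsilon> - d\<^sup>2 / L" by linarith
      then have "2 * rate * - (d * (w x - v x)) \<le> 2 * rate * (\<epsilon> - d\<^sup>2 / L)"
        using rate by (intro mult_left_mono) auto
      then show ?case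
        using elim by (simp add: g_def d_def x_def algebra_simps)
    qed
  qed (use int_cm int_u in auto)
  also have "\<dots> = 2 * rate * \<epsilon> - 2 * rate / L * risk w"
    unfolding risk_def using integrable_risk[OF w]
    by (subst Bochner_Integration.integral_diff) (auto simp: D.prob_space)
  finally show ?thesis .
qed

text \<open>Both claims go through one induction because \<open>shrink\<close> depends on norm and
  score alike. Measurability has to be joint in sample and point: each round evaluates the score at
  a point taken from the sample itself.\<close>

lemma score_meas:
  assumes "t \<le> k"
  shows "(\<lambda>p. score (fst p) t (snd p)) \<in> borel_measurable (Pi\<^sub>M {..<k} (\<lambda>_. D) \<Otimes>\<^sub>M XM) \<and>
    (\<lambda>S. norm_sq S t) \<in> borel_measurable (Pi\<^sub>M {..<k} (\<lambda>_. D))"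
  using assms
proof (induction t)
  case (Suc t)
  let ?P = "Pi\<^sub>M {..<k} (\<lambda>_. D)"
  note [measurable] = K_meas
  have sc [measurable]: "(\<lambda>p. score (fst p) t (snd p)) \<in> borel_measurable (?P \<Otimes>\<^sub>M XM)"
    and nq [measurable]: "(\<lambda>S. norm_sq S t) \<in> borel_measurable ?P"
    using Suc by auto
  have S_meas [measurable]: "(\<lambda>S. S t) \<in> ?P \<rightarrow>\<^sub>M D"
    using Suc.prems by (intro measurable_component_singleton) simp
  have x_meas [measurable]: "(\<lambda>S. fst (S t)) \<in> ?P \<rightarrow>\<^sub>M XM" by measurable
  have own [measurable]: "(\<lambda>S. score S t (fst (S t))) \<in> borel_measurable ?P"
  proof -
    have "(\<lambda>S. (S, fst (S t))) \<in> ?P \<rightarrow>\<^sub>M ?P \<Otimes>\<^sub>M XM" by measurable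
    from measurable_compose[OF this sc] show ?thesis by simp
  qed
  have kern: "(\<lambda>p. K (g p) (h p)) \<in> borel_measurable M"
    if "g \<in> M \<rightarrow>\<^sub>M XM" "h \<in> M \<rightarrow>\<^sub>M XM" for g h and M :: "'z measure"
    using measurable_compose[OF measurable_Pair[OF that] K_meas] by simp
  have coef [measurable]: "(\<lambda>S. coef S t) \<in> borel_measurable ?P"
    unfolding coef_def by measurable
  have kxx [measurable]: "(\<lambda>S. K (fst (S t)) (fst (S t))) \<in> borel_measurable ?P"
    by (rule kern) measurable
  have kxy [measurable]: "(\<lambda>p. K (fst (fst p t)) (snd p)) \<in> borel_measurable (?P \<Otimes>\<^sub>M XM)"
    by (rule kern) measurable
  have moved [measurable]: "(\<lambda>S. moved_norm_sq S t) \<in> borel_measurable ?P"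
    unfolding moved_norm_sq_def by measurable
  have shrink [measurable]: "(\<lambda>S. shrink S t) \<in> borel_measurable ?P"
    unfolding shrink_def by measurable
  show ?case
    unfolding score_Suc norm_sq_Suc by (intro conjI; measurable)
qed simp

text \<open>A difference of two values of \<open>u\<close> is at most 1 in modulus, so its square is
  at most the modulus, and Lipschitz continuity gives a bound linear in L B instead of a quadratic
  one.\<close>

lemma risk_zero_le: "risk (\<lambda>_. 0) \<le> L * (B + \<epsilon>)"
proof -
  have "risk (\<lambda>_. 0) \<le> (\<integral>z. L * (B + \<epsilon>) \<partial>D)"
    unfolding risk_def
  proof (rule integral_mono_AE)
    show "AE z in D. (u 0 - cm z)\<^sup>2 \<le> L * (B + \<epsilon>)"
      using cond_mean AE_space
    proof eventually_elim
      case (elim z)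
      define x where "x = fst z"
      have x: "x \<in> X" using elim by (auto simp: space_D x_def)
      have "\<bar>v x\<bar> \<le> B" using v B_nonneg by (intro abs_eval_le x)
      then have f: "\<bar>f x\<bar> \<le> B + \<epsilon>" using approx[OF x] by linarith
      have d: "\<bar>u 0 - u (f x)\<bar> \<le> 1" using u_range[of 0] u_range[of "f x"] by auto
      have "(u 0 - u (f x))\<^sup>2 = \<bar>u 0 - u (f x)\<bar> * \<bar>u 0 - u (f x)\<bar>"
        by (simp add: power2_eq_square)
      also have "\<dots> \<le> \<bar>u 0 - u (f x)\<bar> * 1" using d by (intro mult_left_mono) auto
      also have "\<dots> \<le> L * \<bar>f x\<bar>"
        using lipschitz_onD[OF lipschitz, of 0 "f x"] by (simp add: dist_real_def)
      also have "\<dots> \<le> L * (B + \<epsilon>)" using f L_pos by (intro mult_left_mono) auto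
      finally show ?case using elim by (simp add: x_def)
    qed
  qed (use integrable_risk[of "\<lambda>_. 0"] in auto)
  then show ?thesis by (simp add: D.prob_space)
qed

lemma score_meas_fixed:
  assumes "S \<in> space (Pi\<^sub>M {..<k} (\<lambda>_. D))" "t \<le> k"
  shows "score S t \<in> borel_measurable XM"
  using measurable_Pair2[of "\<lambda>p. score (fst p) t (snd p)", OF _ assms(1)] score_meas[OF assms(2)]
  by simp

lemma sample_in:
  assumes "S \<in> space (Pi\<^sub>M {..<k} (\<lambda>_. D))" "i < k"
  shows "fst (S i) \<in> X \<and> snd (S i) \<in> {0..1}"
proof -
  have "S i \<in> space D" using assms by (auto simp: space_PiM PiE_def Pi_def)
  then show ?thesis by (auto simp: space_D)
qed

lemma predictor_meas:
  assumes "T \<le> m"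
  shows "(\<lambda>p. predictor T (fst p) (snd p)) \<in> borel_measurable (Pi\<^sub>M {..<m} (\<lambda>_. D) \<Otimes>\<^sub>M XM)"
proof -
  have "(\<lambda>p. u (score (fst p) t (snd p))) \<in> borel_measurable (Pi\<^sub>M {..<m} (\<lambda>_. D) \<Otimes>\<^sub>M XM)"
    if "t < T" for t
    using score_meas[of t m] that assms by (auto intro: measurable_compose[OF _ u_meas])
  then show ?thesis
    unfolding predictor_def by (intro borel_measurable_divide borel_measurable_add borel_measurable_sum) auto
qed

lemma err_predictor_le:
  assumes S: "S \<in> space (Pi\<^sub>M {..<m} (\<lambda>_. D))" and T: "T \<le> m"
  shows "err n X D (predictor T S) \<le>
    ennreal ((risk (\<lambda>_. 0) + (\<Sum>t<T. risk (score S t))) / (real T + 1))"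
proof -
  let ?e = "\<lambda>w z. (u (w (fst z)) - cm z)\<^sup>2"
  let ?bound = "\<lambda>z. (?e (\<lambda>_. 0) z + (\<Sum>t<T. ?e (score S t) z)) / (real T + 1)"
  have int: "integrable D (?e (score S t))" if "t < T" for t
    using score_meas_fixed[OF S] that T by (intro integrable_risk) auto
  have int0: "integrable D (?e (\<lambda>_. 0))" by (intro integrable_risk) simp
  have pointwise: "(predictor T S (fst z) - cm z)\<^sup>2 \<le> ?bound z" for z
  proof -
    \<comment> \<open>Index 0 is the additional summand \<open>u 0\<close> and index t + 1 belongs
      to iterate t, so the average has T + 1 terms.\<close>
    define d where "d t = (if t = 0 then u 0 else u (score S (t - 1) (fst z))) - cm z" for t :: nat
    have split: "(\<Sum>t<Suc T. h (d t)) = h (u 0 - cm z) + (\<Sum>t<T. h (u (score S t (fst z)) - cm z))"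
      for h :: "real \<Rightarrow> real"
      by (subst sum.lessThan_Suc_shift) (simp add: d_def)
    have "(predictor T S (fst z) - cm z) * (real T + 1) = (\<Sum>t<Suc T. d t)"
    proof -
      have "predictor T S (fst z) * (real T + 1) = u 0 + (\<Sum>t<T. u (score S t (fst z)))"
        by (simp add: predictor_def add_nonneg_eq_0_iff)
      then show ?thesis
        using split[of "\<lambda>x. x"] by (simp add: algebra_simps sum_subtractf)
    qed
    then have "((predictor T S (fst z) - cm z) * (real T + 1))\<^sup>2 \<le> (\<Sum>t<Suc T. (d t)\<^sup>2) * (real T + 1)"
      using sum_squared_le_sum_of_squares[of d "{..<Suc T}"] by (simp add: algebra_simps)
    then have "(predictor T S (fst z) - cm z)\<^sup>2 * (real T + 1) \<le> (\<Sum>t<Suc T. (d t)\<^sup>2)"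
      by (simp add: power_mult_distrib power2_eq_square[of "real T + 1"] mult.assoc[symmetric])
    then show ?thesis
      using split[of "\<lambda>x. x\<^sup>2"] by (simp add: field_simps)
  qed
  have "err n X D (predictor T S) \<le> (\<integral>\<^sup>+ z. ennreal (?bound z) \<partial>D)"
    unfolding err_def by (intro nn_integral_mono ennreal_leI pointwise)
  also have "\<dots> = ennreal (\<integral>z. ?bound z \<partial>D)"
    using int int0
    by (intro nn_integral_eq_integral integrable_divide_zero Bochner_Integration.integrable_add
        Bochner_Integration.integrable_sum) (auto intro!: AE_I2 divide_nonneg_nonneg add_nonneg_nonneg sum_nonneg)
  also have "(\<integral>z. ?bound z \<partial>D) = (risk (\<lambda>_. 0) + (\<Sum>t<T. risk (score S t))) / (real T + 1)"
    using Bochner_Integration.integral_add[OF int0 Bochner_Integration.integrable_sum, of "{..<T}"]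
      Bochner_Integration.integral_sum[of "{..<T}" D "\<lambda>t. ?e (score S t)"] int
    by (simp add: risk_def)
  finally show ?thesis .
qed

end

text \<open>For B > 0 this is 1 / rate = 1 / B + L / \<epsilon>, a smooth form of the minimum of B
  and \<epsilon> / L. It satisfies both rate <= B and L rate <= \<epsilon>, and makes L B^2 / rate
  equal to B L + (B L)^2 / \<epsilon>.\<close>

definition learning_rate :: "real \<Rightarrow> real \<Rightarrow> real \<Rightarrow> real" where
  "learning_rate B L \<epsilon> = B * \<epsilon> / (\<epsilon> + B * L)"

text \<open>Here \<open>\<rho>\<close> stands for ln (1 / \<delta>). \<open>T_ge\<close> is the
  sample size condition multiplied out; together with \<open>B_pos\<close> it makes T = 0 equivalent
  to B = 0, so that the rate is positive whenever a round is played.\<close>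

locale tuned_learning = alphatron_learning +
  fixes m T :: nat and \<rho> :: real
  assumes rate_eq: "rate = learning_rate B L \<epsilon>"
    and eps_pos: "0 < \<epsilon>" and rho_pos: "0 < \<rho>"
    and T_le: "T \<le> m" and T_ge: "(B * L)\<^sup>2 * \<rho> \<le> \<epsilon>\<^sup>2 * real T"
    and B_pos: "0 < T \<Longrightarrow> 0 < B"
begin

abbreviation sample :: "(nat \<Rightarrow> vec \<times> real) measure" where
  "sample \<equiv> Pi\<^sub>M {..<m} (\<lambda>_. D)"

definition deviation :: "(nat \<Rightarrow> vec \<times> real) \<Rightarrow> real" where
  "deviation S = (\<Sum>t<T. drift (score S t) (S t) - (\<integral>z. drift (score S t) z \<partial>D))"

lemma BL_sq_le: "(B * L)\<^sup>2 \<le> \<epsilon>\<^sup>2 * real T / \<rho>"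
  using T_ge rho_pos by (simp add: field_simps)

lemma BL_sq_div_le: "(B * L)\<^sup>2 / \<epsilon> \<le> \<epsilon> * real T / \<rho>"
  using BL_sq_le eps_pos by (simp add: divide_le_eq power2_eq_square mult_ac)

text \<open>AM-GM. A bare B L arises from the risk of the zero predictor and from L B^2 / rate; this
  converts it into \<epsilon> and (B L)^2 / \<epsilon>, the quantity that the sample size
  controls.\<close>

lemma BL_le: "B * L \<le> \<epsilon> + (B * L)\<^sup>2 / \<epsilon>"
proof -
  have "2 * (\<epsilon> * (B * L)) \<le> \<epsilon>\<^sup>2 + (B * L)\<^sup>2"
    using zero_le_power2[of "\<epsilon> - B * L"] by (simp add: power2_diff)
  moreover have "0 \<le> \<epsilon> * (B * L)" using eps_pos B_nonneg L_pos by simp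
  ultimately have "\<epsilon> * (B * L) \<le> \<epsilon>\<^sup>2 + (B * L)\<^sup>2" by linarith
  then show ?thesis using eps_pos by (simp add: field_simps power2_eq_square)
qed

text \<open>The threshold is chosen so that multiplication by L / (2 rate), which turns drift into
  risk, leaves 6 \<epsilon> per round.\<close>

lemma deviation_tail:
  assumes "0 < T"
  shows "deviation \<in> borel_measurable sample"
    and "measure sample {S \<in> space sample. 12 * rate * \<epsilon> * real T / L \<le> deviation S} \<le> exp (- \<rho>)"
proof -
  have B: "0 < B" using B_pos assms by simp
  then have rate0: "0 < rate"
    using eps_pos L_pos by (simp add: rate_eq learning_rate_def add_pos_pos)
  \<comment> \<open>The minimiser a / (T A^2) of the exponent T l^2 A^2 / 2 - l a, for A = 6 rate B
    and a = 12 rate \<epsilon> T / L.\<close>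
  define l where "l = \<epsilon> / (3 * L * rate * B\<^sup>2)"
  have l: "0 < l" using rate0 B L_pos eps_pos by (simp add: l_def)
  have meas: "case_prod (\<lambda>S. drift (score S i)) \<in> borel_measurable (Pi\<^sub>M {..<i} (\<lambda>_. D) \<Otimes>\<^sub>M D)" for i
  proof -
    let ?P = "Pi\<^sub>M {..<i} (\<lambda>_. D)"
    have "(\<lambda>p. (fst p, fst (snd p))) \<in> ?P \<Otimes>\<^sub>M D \<rightarrow>\<^sub>M ?P \<Otimes>\<^sub>M XM" by measurable
    from measurable_compose[OF this conjunct1[OF score_meas[OF order_refl]]]
    have [measurable]: "(\<lambda>p. score (fst p) i (fst (snd p))) \<in> borel_measurable (?P \<Otimes>\<^sub>M D)" by simp
    show ?thesis unfolding drift_def case_prod_unfold by measurable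
  qed
  have adapted: "drift (score S i) z = drift (score S' i) z" if "\<And>j. j < i \<Longrightarrow> S j = S' j" for i S S' z
    using score_cong[of i S S'] that by simp
  have bound: "\<bar>drift (score S i) z\<bar> \<le> 6 * rate * B"
    if "S \<in> space (Pi\<^sub>M {..<i} (\<lambda>_. D))" "z \<in> space D" for i S z
    using that sample_in[OF that(1)]
    by (intro abs_drift_le abs_score_diff_le) (auto simp: space_D)
  note tail = D.adapted_sum_tail[of T m l "\<lambda>i S. drift (score S i)" "6 * rate * B",
      OF T_le l meas adapted bound, folded deviation_def]
  show "deviation \<in> borel_measurable sample" using tail(1) by (simp add: deviation_def[abs_def])
  have "measure sample {S \<in> space sample. 12 * rate * \<epsilon> * real T / L \<le> deviation S} \<le>
    exp (real T * l\<^sup>2 * (6 * rate * B)\<^sup>2 / 2 - l * (12 * rate * \<epsilon> * real T / L))"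
    using tail(2) by blast
  also have "real T * l\<^sup>2 * (6 * rate * B)\<^sup>2 / 2 - l * (12 * rate * \<epsilon> * real T / L) =
      - (2 * (\<epsilon>\<^sup>2 * real T / (B * L)\<^sup>2))"
    using B rate0 L_pos by (simp add: l_def power2_eq_square field_simps)
  also have "\<dots> \<le> - \<rho>"
  proof -
    have "\<rho> \<le> \<epsilon>\<^sup>2 * real T / (B * L)\<^sup>2" using T_ge B L_pos by (simp add: field_simps)
    then show ?thesis using rho_pos by linarith
  qed
  finally show "measure sample {S \<in> space sample. 12 * rate * \<epsilon> * real T / L \<le> deviation S} \<le> exp (- \<rho>)"
    by simp
qed

text \<open>The expected drifts and the potential bound control 2 rate / L times the total risk.
  After multiplication by L / (2 rate), the deviation contributes 6 \<epsilon> and the squared rate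
  at most \<epsilon> / 2 per round, together at most 7 \<epsilon>; the initial distance B^2 becomes
  L B^2 / (2 rate), the source of \<epsilon> / \<rho> and of the final \<epsilon> / 2.\<close>

lemma sum_risk_le:
  assumes S: "S \<in> space sample" and dev: "deviation S \<le> 12 * rate * \<epsilon> * real T / L" and "0 < T"
  shows "(\<Sum>t<T. risk (score S t)) \<le> (L * \<epsilon> + 7 * \<epsilon> + \<epsilon> / \<rho>) * real T + \<epsilon> / 2"
proof -
  have B: "0 < B" using B_pos assms by simp
  then have rate0: "0 < rate"
    using eps_pos L_pos by (simp add: rate_eq learning_rate_def add_pos_pos)
  define R where "R = (\<Sum>t<T. risk (score S t))"
  have "(\<Sum>t<T. \<integral>z. drift (score S t) z \<partial>D) \<le> (\<Sum>t<T. 2 * rate * \<epsilon> - 2 * rate / L * risk (score S t))"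
    using S T_le sample_in[OF S]
    by (intro sum_mono expected_drift_le score_meas_fixed[OF S] abs_score_diff_le) auto
  also have "\<dots> = 2 * rate * \<epsilon> * real T - 2 * rate / L * R"
    by (simp add: sum_subtractf sum_distrib_left R_def)
  finally have "2 * rate / L * R \<le> 2 * rate * \<epsilon> * real T - (\<Sum>t<T. \<integral>z. drift (score S t) z \<partial>D)" by linarith
  also have "\<dots> = 2 * rate * \<epsilon> * real T - (\<Sum>t<T. drift (score S t) (S t)) + deviation S"
    by (simp add: deviation_def sum_subtractf)
  also have "(\<Sum>t<T. drift (score S t) (S t)) =
      (\<Sum>t<T. 2 * coef S t * (score S t (fst (S t)) - v (fst (S t))))"
    by (simp add: drift_def coef_def)
  also have "2 * rate * \<epsilon> * real T - \<dots> + deviation S \<le>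
      2 * rate * \<epsilon> * real T + B\<^sup>2 + real T * rate\<^sup>2 + 12 * rate * \<epsilon> * real T / L"
    using potential[of T S] sample_in[OF S] T_le dev by simp
  finally have "L / (2 * rate) * (2 * rate / L * R) \<le> L / (2 * rate) *
      (2 * rate * \<epsilon> * real T + B\<^sup>2 + real T * rate\<^sup>2 + 12 * rate * \<epsilon> * real T / L)"
    using L_pos rate0 by (intro mult_left_mono) auto
  moreover have "L / (2 * rate) * (2 * rate / L * R) = R" using L_pos rate0 by simp
  moreover have "L / (2 * rate) *
      (2 * rate * \<epsilon> * real T + B\<^sup>2 + real T * rate\<^sup>2 + 12 * rate * \<epsilon> * real T / L) =
      L * \<epsilon> * real T + L * B\<^sup>2 / rate / 2 + real T * (L * rate) / 2 + 6 * (\<epsilon> * real T)"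
    using L_pos rate0 by (simp add: power2_eq_square field_simps)
  ultimately have R: "R \<le> L * \<epsilon> * real T + L * B\<^sup>2 / rate / 2 + real T * (L * rate) / 2 + 6 * (\<epsilon> * real T)"
    by linarith
  have "L * rate \<le> \<epsilon>"
    using B L_pos eps_pos by (simp add: rate_eq learning_rate_def field_simps add_pos_pos)
  then have "real T * (L * rate) / 2 \<le> 1 / 2 * (\<epsilon> * real T)"
    using mult_left_mono[of "L * rate" \<epsilon> "real T"] by (simp add: mult.commute)
  moreover have "L * B\<^sup>2 / rate / 2 \<le> \<epsilon> / 2 + \<epsilon> * real T / \<rho>"
  proof -
    have "L * B\<^sup>2 / rate = B * L + (B * L)\<^sup>2 / \<epsilon>"
      using B L_pos eps_pos
      by (simp add: rate_eq learning_rate_def power2_eq_square field_simps add_pos_pos)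
    moreover have "a / 2 \<le> \<epsilon> / 2 + c" if "a = b + q" "b \<le> \<epsilon> + q" "q \<le> c" for a b c q
      using that by linarith
    ultimately show ?thesis using BL_le BL_sq_div_le by blast
  qed
  moreover have "0 \<le> \<epsilon> * real T" using eps_pos by simp
  moreover have "(L * \<epsilon> + 7 * \<epsilon> + \<epsilon> / \<rho>) * real T = L * \<epsilon> * real T + 7 * (\<epsilon> * real T) + \<epsilon> * real T / \<rho>"
    by (simp add: distrib_right)
  ultimately have "R \<le> (L * \<epsilon> + 7 * \<epsilon> + \<epsilon> / \<rho>) * real T + \<epsilon> / 2"
    using R by linarith
  then show ?thesis by (simp add: R_def)
qed

text \<open>One of the two terms \<epsilon> / \<rho> comes from the initial distance to
  \<open>v\<close>, the other from the zero predictor, whose risk is not small by itself but is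
  divided by T + 1.\<close>

lemma good_sample:
  assumes c: "L * \<epsilon> + \<epsilon> * (8 + 2 / \<rho>) \<le> c"
  shows "measure sample {S \<in> space sample. predictor T S \<in> borel_measurable XM \<and>
     err n X D (predictor T S) \<le> ennreal c} \<ge> 1 - exp (- \<rho>)"
    (is "measure sample ?good \<ge> _")
proof -
  interpret P: prob_space sample by (intro prob_space_PiM) (rule D.prob_space_axioms)
  note pred [measurable] = predictor_meas[OF T_le]
  have pred_meas: "predictor T S \<in> borel_measurable XM" if "S \<in> space sample" for S
    using measurable_Pair2[OF pred that] by simp
  \<comment> \<open>Measurability of the good event matters: outside \<open>sets sample\<close> its
    \<open>measure\<close> would be the default value 0.\<close>
  have "(\<lambda>S. err n X D (predictor T S)) \<in> borel_measurable sample"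
  proof -
    have "(\<lambda>p. (fst p, fst (snd p))) \<in> sample \<Otimes>\<^sub>M D \<rightarrow>\<^sub>M sample \<Otimes>\<^sub>M XM" by measurable
    from measurable_compose[OF this pred]
    have [measurable]: "(\<lambda>p. predictor T (fst p) (fst (snd p))) \<in> borel_measurable (sample \<Otimes>\<^sub>M D)" by simp
    have "(\<lambda>(S, z). ennreal ((predictor T S (fst z) - cm z)\<^sup>2)) \<in> borel_measurable (sample \<Otimes>\<^sub>M D)"
      unfolding case_prod_unfold by measurable
    then show ?thesis unfolding err_def by (rule D.borel_measurable_nn_integral)
  qed
  then have "{S \<in> space sample. err n X D (predictor T S) \<le> ennreal c} \<in> sets sample"
    by measurable
  also have "{S \<in> space sample. err n X D (predictor T S) \<le> ennreal c} = ?good"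
    using pred_meas by auto
  finally have good_sets: "?good \<in> sets sample" .
  have good: "S \<in> ?good" if S: "S \<in> space sample"
    and R: "(\<Sum>t<T. risk (score S t)) \<le> (L * \<epsilon> + 7 * \<epsilon> + \<epsilon> / \<rho>) * real T + \<epsilon> / 2" for S
  proof -
    have "risk (\<lambda>_. 0) \<le> L * \<epsilon> + B * L" using risk_zero_le by (simp add: algebra_simps)
    also have "\<dots> \<le> L * \<epsilon> + (\<epsilon> + \<epsilon> * real T / \<rho>)" using BL_le BL_sq_div_le by linarith
    finally have "risk (\<lambda>_. 0) + (\<Sum>t<T. risk (score S t)) \<le>
        L * \<epsilon> + (\<epsilon> + \<epsilon> * real T / \<rho>) + ((L * \<epsilon> + 7 * \<epsilon> + \<epsilon> / \<rho>) * real T + \<epsilon> / 2)"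
      using R by linarith
    also have "\<dots> \<le> (L * \<epsilon> + \<epsilon> * (8 + 2 / \<rho>)) * (real T + 1)"
    proof -
      have "0 \<le> \<epsilon> / \<rho>" "0 \<le> \<epsilon> * real T" using eps_pos rho_pos by simp_all
      moreover have "(L * \<epsilon> + \<epsilon> * (8 + 2 / \<rho>)) * (real T + 1) = L * \<epsilon> * real T + 8 * (\<epsilon> * real T) +
          2 * (\<epsilon> * real T / \<rho>) + L * \<epsilon> + 8 * \<epsilon> + 2 * (\<epsilon> / \<rho>)"
        "(L * \<epsilon> + 7 * \<epsilon> + \<epsilon> / \<rho>) * real T = L * \<epsilon> * real T + 7 * (\<epsilon> * real T) + \<epsilon> * real T / \<rho>"
        by (simp_all add: distrib_left distrib_right add_divide_distrib mult_ac)
      ultimately show ?thesis using eps_pos by linarith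
    qed
    finally have "(risk (\<lambda>_. 0) + (\<Sum>t<T. risk (score S t))) / (real T + 1) \<le> L * \<epsilon> + \<epsilon> * (8 + 2 / \<rho>)"
      by (simp add: divide_le_eq)
    also note c
    finally have "(risk (\<lambda>_. 0) + (\<Sum>t<T. risk (score S t))) / (real T + 1) \<le> c" .
    then have "err n X D (predictor T S) \<le> ennreal c"
      using err_predictor_le[OF S T_le] by (meson ennreal_leI order_trans)
    then show ?thesis using S pred_meas by simp
  qed
  show ?thesis
  proof (cases "T = 0")
    case True
    \<comment> \<open>The sum over rounds is empty, so the bound holds for every sample.\<close>
    then have "?good = space sample" using good eps_pos by auto
    then show ?thesis by (simp add: P.prob_space)
  next
    case False
    let ?bad = "{S \<in> space sample. 12 * rate * \<epsilon> * real T / L \<le> deviation S}"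
    have [measurable]: "deviation \<in> borel_measurable sample" using deviation_tail(1) False by simp
    have "1 - exp (- \<rho>) \<le> 1 - measure sample ?bad" using deviation_tail(2) False by simp
    also have "\<dots> = measure sample (space sample - ?bad)"
      by (rule P.prob_compl[symmetric]) measurable
    also have "\<dots> \<le> measure sample ?good"
    proof (rule P.finite_measure_mono[OF _ good_sets], rule subsetI)
      fix S assume "S \<in> space sample - ?bad"
      then show "S \<in> ?good" using False by (intro good sum_risk_le) auto
    qed
    finally show ?thesis .
  qed
qed

end

section \<open>Timed execution of programs\<close>

text \<open>A total-correctness triple with a time budget. The budget is an upper bound, so the
  branches of a conditional and the rounds of a loop can share one.\<close>

definition runs :: "oracles \<Rightarrow> cmd \<Rightarrow> ram_state \<Rightarrow> nat \<Rightarrow> (ram_state \<Rightarrow> bool) \<Rightarrow> bool" where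
  "runs E c s T P \<longleftrightarrow> (\<exists>t s'. exec E c s t s' \<and> t \<le> T \<and> P s')"

lemma runs_Skip: "P s \<Longrightarrow> 1 \<le> T \<Longrightarrow> runs E Skip s T P"
  unfolding runs_def using exec.Skip by blast

lemma runs_mono: "runs E c s T P \<Longrightarrow> T \<le> T' \<Longrightarrow> (\<And>s'. P s' \<Longrightarrow> Q s') \<Longrightarrow> runs E c s T' Q"
  unfolding runs_def by (meson order_trans)

lemma runs_Seq:
  assumes "runs E c1 s T1 P" "\<And>s'. P s' \<Longrightarrow> runs E c2 s' T2 Q"
  shows "runs E (Seq c1 c2) s (T1 + T2) Q"
  using assms unfolding runs_def by (meson exec.Seq add_mono)

lemma runs_If:
  assumes "holds b s \<Longrightarrow> runs E c1 s T P" "\<not> holds b s \<Longrightarrow> runs E c2 s T P"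
  shows "runs E (If b c1 c2) s (Suc T) P"
proof (cases "holds b s")
  case True
  then obtain t s' where "exec E c1 s t s'" "t \<le> T" "P s'"
    using assms(1) unfolding runs_def by blast
  then show ?thesis unfolding runs_def using exec.IfTrue[OF True] by (metis Suc_le_mono plus_1_eq_Suc)
next
  case False
  then obtain t s' where "exec E c2 s t s'" "t \<le> T" "P s'"
    using assms(2) unfolding runs_def by blast
  then show ?thesis unfolding runs_def using exec.IfFalse[OF False] by (metis Suc_le_mono plus_1_eq_Suc)
qed

text \<open>The invariant is indexed by the number of completed iterations, and the total
  \<open>N\<close> is known beforehand; each iteration pays one unit for the test, and the failing
  test at the end pays one more.\<close>

lemma runs_While:
  assumes init: "I i s" and le: "i \<le> N"
    and body: "\<And>i s. I i s \<Longrightarrow> i < N \<Longrightarrow> holds b s \<and> runs E c s T (I (Suc i))"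
    and exit: "\<And>s. I N s \<Longrightarrow> \<not> holds b s"
  shows "runs E (While b c) s (Suc ((N - i) * Suc T)) (I N)"
  using le init
proof (induction i arbitrary: s rule: inc_induct)
  case base
  then show ?case
    unfolding runs_def using exec.WhileFalse[OF exit] by fastforce
next
  case (step i)
  from body[OF step.prems step.hyps(2)] obtain t1 s1
    where b: "holds b s" and 1: "exec E c s t1 s1" "t1 \<le> T" "I (Suc i) s1"
    unfolding runs_def by blast
  from step.IH[OF 1(3)] obtain t2 s2
    where 2: "exec E (While b c) s1 t2 s2" "t2 \<le> Suc ((N - Suc i) * Suc T)" "I N s2"
    unfolding runs_def by blast
  have "(N - i) * Suc T = (N - Suc i) * Suc T + Suc T"
    using step.hyps(2) by (metis Suc_diff_Suc add.commute mult_Suc)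
  then show ?case
    unfolding runs_def using exec.WhileTrue[OF b 1(1) 2(1)] 1(2) 2(2,3) by fastforce
qed

fun block :: "instr list \<Rightarrow> cmd" where
  "block [] = Skip"
| "block (a # as) = Seq (Instr a) (block as)"

lemma cost_le: "cost E a \<le> 1 + kcost E"
  by (cases a) auto

text \<open>Straight-line code is evaluated by \<open>fold\<close>, which simp can unfold. Every
  instruction is charged as if it called the kernel, which costs only a constant factor; the extra
  unit is the closing \<open>Skip\<close>.\<close>

lemma runs_block:
  "P (fold (step E) as s) \<Longrightarrow> Suc (length as * Suc (kcost E)) \<le> T \<Longrightarrow> runs E (block as) s T P"
proof -
  have "\<exists>t. exec E (block as) s t (fold (step E) as s) \<and> t \<le> Suc (length as * Suc (kcost E))"
  proof (induction as arbitrary: s)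
    case Nil
    then show ?case using exec.Skip by auto
  next
    case (Cons a as)
    obtain t where "exec E (block as) (step E a s) t (fold (step E) as (step E a s))"
      "t \<le> Suc (length as * Suc (kcost E))" using Cons by blast
    then show ?case using exec.Seq[OF exec.Instr] cost_le[of E a] by fastforce
  qed
  then show "P (fold (step E) as s) \<Longrightarrow> Suc (length as * Suc (kcost E)) \<le> T \<Longrightarrow> runs E (block as) s T P"
    unfolding runs_def using order_trans by blast
qed

section \<open>The programs\<close>

text \<open>Round \<open>t\<close> stores \<open>coef\<close> and \<open>shrink\<close> in the columns \<open>n + 1\<close>, \<open>n + 2\<close> of row \<open>t\<close>. Index registers 2
  to 6 hold \<open>T\<close>, \<open>t\<close>, the inner loop counter and these two columns; real registers 8, 9, 10, 14 hold
  the learning rate, the squared norm of the iterate, the current score and \<open>B\<^sup>2\<close>.\<close>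

definition advance :: "nat \<Rightarrow> instr list" where
  "advance r = [CallKernel 11 4 r, Load 12 4 5, RMul 11 11 12, RAdd 10 10 11, Load 12 4 6,
     RMul 10 10 12, IInc 4]"

text \<open>One loop doubles \<delta> up to 1 and adds (B L / \<epsilon>)^2 to a register each time.
  The next loop counts an index register up to the ceiling of that sum, as reals cannot be converted
  into indices, and the result is capped by m.\<close>

definition choose_parameters :: cmd where
  "choose_parameters =
    Seq (block [RConst 4 1, RMul 5 0 1, RMul 8 0 2, RAdd 6 2 5, RDiv 8 8 6, RDiv 5 5 2,
      RMul 5 5 5, RConst 6 0])
   (Seq (While (RLess 3 4) (block [RAdd 3 3 3, RAdd 6 6 5]))
   (Seq (While (RLess 7 6) (block [RAdd 7 7 4, IInc 2]))
   (Seq (If (ILess 2 1) Skip (block [ICopy 2 1]))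
        (block [ICopy 5 0, IInc 5, ICopy 6 5, IInc 6, RMul 14 0 0]))))"

text \<open>The inner loop replays the score recurrence at the current example, so round t takes t
  steps of \<open>advance\<close>. The repeated \<open>RAdd 9 9 11\<close> supplies the factor 2 of
  the cross term in the squared norm.\<close>

definition train_round :: cmd where
  "train_round =
    Seq (block [RConst 10 0, IConst 4 0])
   (Seq (While (ILess 4 3) (block (advance 3)))
   (Seq (block [Load 12 3 0, CallLink 11 10, RSub 12 12 11, RMul 12 12 8, Store 3 5 12,
      RMul 11 12 10, RAdd 9 9 11, RAdd 9 9 11, CallKernel 11 3 3, RMul 12 12 12, RMul 11 11 12,
      RAdd 9 9 11, RConst 13 1])
   (Seq (If (RLess 14 9) (block [RDiv 13 14 9, RAdd 13 13 4, RConst 11 2, RDiv 13 13 11]) Skip)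
        (block [Store 3 6 13, RMul 9 9 13, RMul 9 9 13, IInc 3]))))"

definition train_cmd :: cmd where
  "train_cmd = Seq choose_parameters (While (ILess 3 2) train_round)"

text \<open>Index register 1 holds m, the row of the query, hence \<open>advance 1\<close>. Real
  register 3 starts at 1 and is incremented along with the loop: it is the real number T + 1 by
  which the sum is divided.\<close>

definition predict_cmd :: cmd where
  "predict_cmd =
    Seq (block [RConst 10 0, RConst 3 1, CallLink 0 10, IConst 4 0])
   (Seq (While (ILess 4 2) (block (CallLink 11 10 # RAdd 0 0 11 # RAdd 3 3 4 # advance 1)))
        (block [RDiv 0 0 3]))"

text \<open>The machine has no logarithm; the number of doublings that lift \<open>\<delta>\<close> to \<open>1\<close> replaces
  \<open>log 2 (1 / \<delta>)\<close>.\<close>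

definition doublings :: "real \<Rightarrow> nat" where
  "doublings \<delta> = (LEAST k. 1 \<le> 2 ^ k * \<delta>)"

text \<open>As the logarithm is replaced by an upper bound and the product is rounded up, this may
  exceed the number of available examples; the number of rounds is therefore its minimum with
  m.\<close>

definition sample_budget :: "real \<Rightarrow> real \<Rightarrow> real \<Rightarrow> real \<Rightarrow> nat" where
  "sample_budget B L \<epsilon> \<delta> = nat \<lceil>(B * L / \<epsilon>)\<^sup>2 * real (doublings \<delta>)\<rceil>"

lemma doublings:
  assumes "0 < \<delta>"
  shows "1 \<le> 2 ^ doublings \<delta> * \<delta>" and "i < doublings \<delta> \<Longrightarrow> 2 ^ i * \<delta> < 1"
proof -
  obtain k where "1 / \<delta> < 2 ^ k" using real_arch_pow[of 2 "1 / \<delta>"] by auto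
  then have "1 \<le> 2 ^ k * \<delta>" using assms by (simp add: field_simps)
  then show "1 \<le> 2 ^ doublings \<delta> * \<delta>" unfolding doublings_def by (rule LeastI)
  show "i < doublings \<delta> \<Longrightarrow> 2 ^ i * \<delta> < 1"
    unfolding doublings_def using not_less_Least by force
qed

section \<open>Correctness and running time of the programs\<close>

lemma runs_choose_parameters:
  fixes E :: oracles and n m :: nat and B L \<epsilon> \<delta> :: real and S :: "nat \<Rightarrow> vec \<times> real"
  assumes "0 < \<delta>"
  defines "k \<equiv> doublings \<delta>" and "N \<equiv> sample_budget B L \<epsilon> \<delta>"
    and "c \<equiv> Suc (kcost E)"
    and "s0 \<equiv> initial_state n m B L \<epsilon> \<delta> S"
  shows "runs E choose_parameters s0 (30 * c * (k + N + 1))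
    (\<lambda>s. idx s 0 = n \<and> idx s 1 = m \<and> idx s 2 = min m N \<and> idx s 3 = 0 \<and> idx s 5 = Suc n \<and>
       idx s 6 = Suc (Suc n) \<and> reg s 4 = 1 \<and> reg s 8 = learning_rate B L \<epsilon> \<and> reg s 9 = 0 \<and>
       reg s 14 = B\<^sup>2 \<and> mem s = mem s0)"
proof -
  define a where "a = (B * L / \<epsilon>)\<^sup>2"
  define I0 where "I0 s \<longleftrightarrow> idx s 0 = n \<and> idx s 1 = m \<and> idx s 3 = 0 \<and> reg s 0 = B \<and> reg s 4 = 1 \<and>
    reg s 8 = learning_rate B L \<epsilon> \<and> reg s 9 = 0 \<and> mem s = mem s0" for s :: ram_state
  define I1 where "I1 i s \<longleftrightarrow> I0 s \<and> idx s 2 = 0 \<and> reg s 7 = 0 \<and> reg s 5 = a \<and>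
    reg s 3 = 2 ^ i * \<delta> \<and> reg s 6 = a * real i" for i and s :: ram_state
  define I2 where "I2 i s \<longleftrightarrow> I0 s \<and> idx s 2 = i \<and> reg s 7 = real i \<and> reg s 6 = a * real k" for i and s :: ram_state
  define I3 where "I3 s \<longleftrightarrow> I0 s \<and> idx s 2 = min m N" for s :: ram_state
  have N: "N = nat \<lceil>a * real k\<rceil>" by (simp add: N_def sample_budget_def a_def k_def)
  have 1: "runs E (block [RConst 4 1, RMul 5 0 1, RMul 8 0 2, RAdd 6 2 5, RDiv 8 8 6, RDiv 5 5 2,
      RMul 5 5 5, RConst 6 0]) s0 (Suc (8 * c)) (I1 0)"
    by (rule runs_block)
      (simp_all add: I1_def I0_def s0_def initial_state_def c_def a_def learning_rate_def
        power2_eq_square)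
  have 2: "runs E (While (RLess 3 4) (block [RAdd 3 3 3, RAdd 6 6 5])) s
      (Suc ((k - 0) * Suc (Suc (2 * c)))) (I1 k)" if "I1 0 s" for s
    using that
  proof (rule runs_While)
    fix i s assume I: "I1 i s" and "i < k"
    then have "2 ^ i * \<delta> < 1" using doublings(2)[OF assms(1)] by (simp add: k_def)
    moreover have "runs E (block [RAdd 3 3 3, RAdd 6 6 5]) s (Suc (2 * c)) (I1 (Suc i))"
      using I by (intro runs_block) (simp_all add: I1_def I0_def c_def algebra_simps)
    ultimately show "holds (RLess 3 4) s \<and>
      runs E (block [RAdd 3 3 3, RAdd 6 6 5]) s (Suc (2 * c)) (I1 (Suc i))"
      using I by (simp add: I1_def I0_def)
  next
    fix s assume "I1 k s"
    then show "\<not> holds (RLess 3 4) s"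
      using doublings(1)[OF assms(1)] by (simp add: I1_def I0_def k_def)
  qed simp
  have 3: "runs E (While (RLess 7 6) (block [RAdd 7 7 4, IInc 2])) s
      (Suc ((N - 0) * Suc (Suc (2 * c)))) (I2 N)" if "I1 k s" for s
  proof (rule runs_While)
    show "I2 0 s" using that by (simp add: I1_def I2_def)
    fix i s assume I: "I2 i s" and "i < N"
    then have "real i < a * real k" unfolding N by linarith
    moreover have "runs E (block [RAdd 7 7 4, IInc 2]) s (Suc (2 * c)) (I2 (Suc i))"
      using I by (intro runs_block) (simp_all add: I2_def I0_def c_def)
    ultimately show "holds (RLess 7 6) s \<and>
      runs E (block [RAdd 7 7 4, IInc 2]) s (Suc (2 * c)) (I2 (Suc i))"
      using I by (simp add: I2_def)
  next
    fix s assume "I2 N s"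
    moreover have "a * real k \<le> real N" unfolding N by linarith
    ultimately show "\<not> holds (RLess 7 6) s" by (simp add: I2_def)
  qed simp
  have 4: "runs E (If (ILess 2 1) Skip (block [ICopy 2 1])) s (Suc (Suc c)) I3" if "I2 N s" for s
    using that
    by (intro runs_If runs_Skip runs_block) (auto simp: I2_def I3_def I0_def c_def)
  have 5: "runs E (block [ICopy 5 0, IInc 5, ICopy 6 5, IInc 6, RMul 14 0 0]) s (Suc (5 * c))
    (\<lambda>s. idx s 0 = n \<and> idx s 1 = m \<and> idx s 2 = min m N \<and> idx s 3 = 0 \<and> idx s 5 = Suc n \<and>
       idx s 6 = Suc (Suc n) \<and> reg s 4 = 1 \<and> reg s 8 = learning_rate B L \<epsilon> \<and> reg s 9 = 0 \<and>
       reg s 14 = B\<^sup>2 \<and> mem s = mem s0)" if "I3 s" for s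
    using that by (intro runs_block) (simp_all add: I3_def I0_def c_def power2_eq_square)
  show ?thesis
    unfolding choose_parameters_def
  proof (rule runs_mono)
    show "runs E (Seq (block [RConst 4 1, RMul 5 0 1, RMul 8 0 2, RAdd 6 2 5, RDiv 8 8 6, RDiv 5 5 2,
      RMul 5 5 5, RConst 6 0])
   (Seq (While (RLess 3 4) (block [RAdd 3 3 3, RAdd 6 6 5]))
   (Seq (While (RLess 7 6) (block [RAdd 7 7 4, IInc 2]))
   (Seq (If (ILess 2 1) Skip (block [ICopy 2 1]))
        (block [ICopy 5 0, IInc 5, ICopy 6 5, IInc 6, RMul 14 0 0]))))) s0
      (Suc (8 * c) + (Suc ((k - 0) * Suc (Suc (2 * c))) + (Suc ((N - 0) * Suc (Suc (2 * c)))
        + (Suc (Suc c) + Suc (5 * c)))))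
      (\<lambda>s. idx s 0 = n \<and> idx s 1 = m \<and> idx s 2 = min m N \<and> idx s 3 = 0 \<and> idx s 5 = Suc n \<and>
       idx s 6 = Suc (Suc n) \<and> reg s 4 = 1 \<and> reg s 8 = learning_rate B L \<epsilon> \<and> reg s 9 = 0 \<and>
       reg s 14 = B\<^sup>2 \<and> mem s = mem s0)"
      by (rule runs_Seq[OF 1 runs_Seq[OF 2 runs_Seq[OF 3 runs_Seq[OF 4 5]]]])
    show "Suc (8 * c) + (Suc ((k - 0) * Suc (Suc (2 * c))) + (Suc ((N - 0) * Suc (Suc (2 * c)))
        + (Suc (Suc c) + Suc (5 * c)))) \<le> 30 * c * (k + N + 1)"
    proof -
      have "1 \<le> c" by (simp add: c_def)
      then have "k \<le> k * c" "N \<le> N * c" by simp_all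
      moreover have "30 * c * (k + N + 1) = 30 * (k * c) + 30 * (N * c) + 30 * c"
        "(k - 0) * Suc (Suc (2 * c)) = 2 * (k * c) + 2 * k"
        "(N - 0) * Suc (Suc (2 * c)) = 2 * (N * c) + 2 * N"
        by (simp_all add: algebra_simps)
      ultimately show ?thesis using \<open>1 \<le> c\<close> by linarith
    qed
  qed
qed

text \<open>The kernel oracle receives rows restricted to the first n columns. Extensionality of the
  examples ensures that these restrictions are the examples themselves.\<close>

locale alphatron_machine = alphatron K u rate B
  for K :: "vec \<Rightarrow> vec \<Rightarrow> real" and u rate B +
  fixes n m T \<kappa> :: nat and S :: "nat \<Rightarrow> vec \<times> real"
  assumes extensional: "\<And>i. i < m \<Longrightarrow> fst (S i) \<in> extensional {..<n}"
    and T_le: "T \<le> m"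
begin

abbreviation orc :: oracles where
  "orc \<equiv> \<lparr>dim = n, kernel = K, link = u, kcost = \<kappa>\<rparr>"

definition data :: "nat \<Rightarrow> ram_state \<Rightarrow> bool" where
  "data t s \<longleftrightarrow> (\<forall>i<m. restrict (mem s i) {..<n} = fst (S i) \<and> mem s i n = snd (S i)) \<and>
     (\<forall>i<t. mem s i (Suc n) = coef S i \<and> mem s i (Suc (Suc n)) = shrink S i)"

definition layout :: "ram_state \<Rightarrow> bool" where
  "layout s \<longleftrightarrow> idx s 0 = n \<and> idx s 1 = m \<and> idx s 2 = T \<and> idx s 5 = Suc n \<and> idx s 6 = Suc (Suc n) \<and>
     reg s 4 = 1 \<and> reg s 8 = rate \<and> reg s 14 = B\<^sup>2"

lemma initial_data: "data 0 s" if "mem s = mem (initial_state n m B' L \<epsilon> \<delta> S)"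
proof -
  have "restrict (mem s i) {..<n} = fst (S i)" if "i < m" for i
    using \<open>mem s = _\<close> extensional[OF that] that
    by (auto simp: initial_state_def fun_eq_iff extensional_def)
  then show ?thesis using \<open>mem s = _\<close> by (simp add: data_def initial_state_def)
qed

lemma runs_score_loop:
  assumes s: "layout s" "data t s" "idx s 3 = t" "t < m" "idx s 4 = 0" "reg s 10 = 0"
    and x: "x = fst (S t)"
  shows "runs orc (While (ILess 4 3) (block (advance 3))) s (Suc ((t - 0) * Suc (Suc (7 * Suc \<kappa>))))
    (\<lambda>s'. reg s' 10 = score S t x \<and> layout s' \<and> idx s' 3 = t \<and> reg s' 9 = reg s 9 \<and> data t s')"
proof (rule runs_mono[where P = "\<lambda>s'. reg s' 10 = score S t x \<and> layout s' \<and> idx s' 3 = t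
      \<and> reg s' 9 = reg s 9 \<and> data t s' \<and> idx s' 4 = t"])
  let ?I = "\<lambda>i s'. reg s' 10 = score S i x \<and> layout s' \<and> idx s' 3 = t
      \<and> reg s' 9 = reg s 9 \<and> data t s' \<and> idx s' 4 = i"
  show "runs orc (While (ILess 4 3) (block (advance 3))) s
      (Suc ((t - 0) * Suc (Suc (7 * Suc \<kappa>)))) (?I t)"
  proof (rule runs_While[where I = ?I])
    show "?I 0 s" using s by simp
    fix i s' assume I: "?I i s'" and "i < t"
    have "runs orc (block (advance 3)) s' (Suc (7 * Suc \<kappa>)) (?I (Suc i))"
      using I \<open>i < t\<close> \<open>t < m\<close>
      by (intro runs_block)
        (simp_all add: advance_def layout_def data_def score_Suc x mult_ac)
    then show "holds (ILess 4 3) s' \<and> runs orc (block (advance 3)) s' (Suc (7 * Suc \<kappa>)) (?I (Suc i))"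
      using I \<open>i < t\<close> by simp
  qed simp_all
qed simp_all

lemma runs_train_round:
  assumes s: "layout s" "data t s" "idx s 3 = t" "t < m" "reg s 9 = norm_sq S t"
  shows "runs orc train_round s (30 * Suc \<kappa> * (t + 1))
    (\<lambda>s'. layout s' \<and> data (Suc t) s' \<and> idx s' 3 = Suc t \<and> reg s' 9 = norm_sq S (Suc t))"
proof -
  define P1 where "P1 s' \<longleftrightarrow> layout s' \<and> data t s' \<and> idx s' 3 = t \<and> reg s' 9 = norm_sq S t" for s' :: ram_state
  define P3 where "P3 s' \<longleftrightarrow> layout s' \<and> data t s' \<and> idx s' 3 = t \<and> mem s' t (Suc n) = coef S t \<and>
    reg s' 9 = moved_norm_sq S t" for s' :: ram_state
  have 1: "runs orc (block [RConst 10 0, IConst 4 0]) s (Suc (2 * Suc \<kappa>))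
      (\<lambda>s'. P1 s' \<and> idx s' 4 = 0 \<and> reg s' 10 = 0)"
    using s by (intro runs_block) (simp_all add: P1_def layout_def data_def)
  have 2: "runs orc (While (ILess 4 3) (block (advance 3))) s' (Suc ((t - 0) * Suc (Suc (7 * Suc \<kappa>))))
      (\<lambda>s'. P1 s' \<and> reg s' 10 = score S t (fst (S t)))"
    if "P1 s' \<and> idx s' 4 = 0 \<and> reg s' 10 = 0" for s'
    using that \<open>t < m\<close>
    by (intro runs_mono[OF runs_score_loop[of s' t "fst (S t)"]]) (auto simp: P1_def)
  have 3: "runs orc (block [Load 12 3 0, CallLink 11 10, RSub 12 12 11, RMul 12 12 8, Store 3 5 12,
      RMul 11 12 10, RAdd 9 9 11, RAdd 9 9 11, CallKernel 11 3 3, RMul 12 12 12, RMul 11 11 12,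
      RAdd 9 9 11, RConst 13 1]) s' (Suc (13 * Suc \<kappa>)) (\<lambda>s'. P3 s' \<and> reg s' 13 = 1)"
    if P: "P1 s' \<and> reg s' 10 = score S t (fst (S t))" for s'
  proof (rule runs_block)
    \<comment> \<open>The store hits a column beyond the first n, so the kernel call that follows
      still sees the example.\<close>
    have r: "restrict ((mem s' t)(Suc n := c)) {..<n} = fst (S t)" for c
    proof -
      have "restrict ((mem s' t)(Suc n := c)) {..<n} = restrict (mem s' t) {..<n}"
        by (rule restrict_ext) simp
      then show ?thesis using P \<open>t < m\<close> by (simp add: P1_def data_def)
    qed
    have b: "(snd (S t) - u (score S t (fst (S t)))) * rate = coef S t"
      by (simp add: coef_def mult.commute)
    show "P3 (fold (step orc) [Load 12 3 0, CallLink 11 10, RSub 12 12 11, RMul 12 12 8, Store 3 5 12,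
      RMul 11 12 10, RAdd 9 9 11, RAdd 9 9 11, CallKernel 11 3 3, RMul 12 12 12, RMul 11 11 12,
      RAdd 9 9 11, RConst 13 1] s') \<and>
     reg (fold (step orc) [Load 12 3 0, CallLink 11 10, RSub 12 12 11, RMul 12 12 8, Store 3 5 12,
      RMul 11 12 10, RAdd 9 9 11, RAdd 9 9 11, CallKernel 11 3 3, RMul 12 12 12, RMul 11 11 12,
      RAdd 9 9 11, RConst 13 1] s') 13 = 1"
      using P \<open>t < m\<close> r b
      by (simp add: P1_def P3_def layout_def data_def moved_norm_sq_def power2_eq_square algebra_simps)
  qed simp
  have 4: "runs orc (If (RLess 14 9) (block [RDiv 13 14 9, RAdd 13 13 4, RConst 11 2, RDiv 13 13 11]) Skip)
      s' (Suc (Suc (4 * Suc \<kappa>))) (\<lambda>s'. P3 s' \<and> reg s' 13 = shrink S t)"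
    if "P3 s' \<and> reg s' 13 = 1" for s'
    using that
    by (intro runs_If runs_Skip runs_block)
      (auto simp: P3_def layout_def data_def shrink_def add.commute)
  have 5: "runs orc (block [Store 3 6 13, RMul 9 9 13, RMul 9 9 13, IInc 3]) s' (Suc (4 * Suc \<kappa>))
      (\<lambda>s'. layout s' \<and> data (Suc t) s' \<and> idx s' 3 = Suc t \<and> reg s' 9 = norm_sq S (Suc t))"
    if P: "P3 s' \<and> reg s' 13 = shrink S t" for s'
  proof (rule runs_block)
    have r: "restrict ((mem s' t)(Suc (Suc n) := c)) {..<n} = fst (S t)" for c
    proof -
      have "restrict ((mem s' t)(Suc (Suc n) := c)) {..<n} = restrict (mem s' t) {..<n}"
        by (rule restrict_ext) simp
      then show ?thesis using P \<open>t < m\<close> by (simp add: P3_def data_def)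
    qed
    show "layout (fold (step orc) [Store 3 6 13, RMul 9 9 13, RMul 9 9 13, IInc 3] s') \<and>
      data (Suc t) (fold (step orc) [Store 3 6 13, RMul 9 9 13, RMul 9 9 13, IInc 3] s') \<and>
      idx (fold (step orc) [Store 3 6 13, RMul 9 9 13, RMul 9 9 13, IInc 3] s') 3 = Suc t \<and>
      reg (fold (step orc) [Store 3 6 13, RMul 9 9 13, RMul 9 9 13, IInc 3] s') 9 = norm_sq S (Suc t)"
      using P \<open>t < m\<close> r
      by (auto simp: P3_def layout_def data_def norm_sq_Suc power2_eq_square less_Suc_eq)
  qed simp
  show ?thesis
    unfolding train_round_def
    by (rule runs_mono[OF runs_Seq[OF 1 runs_Seq[OF 2 runs_Seq[OF 3 runs_Seq[OF 4 5]]]]])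
      (simp_all add: algebra_simps)
qed

lemma runs_train_loop:
  assumes s: "layout s" "data 0 s" "idx s 3 = 0" "reg s 9 = 0"
  shows "runs orc (While (ILess 3 2) train_round) s (40 * Suc \<kappa> * (T + 1)\<^sup>2)
    (\<lambda>s'. layout s' \<and> data T s')"
proof -
  let ?I = "\<lambda>t s'. layout s' \<and> data t s' \<and> idx s' 3 = t \<and> reg s' 9 = norm_sq S t"
  have "runs orc (While (ILess 3 2) train_round) s
      (Suc ((T - 0) * Suc (30 * Suc \<kappa> * (T + 1)))) (?I T)"
  proof (rule runs_While[where I = ?I])
    show "?I 0 s" using s by simp
    fix t s' assume I: "?I t s'" and "t < T"
    have "runs orc train_round s' (30 * Suc \<kappa> * (t + 1)) (?I (Suc t))"
      using I \<open>t < T\<close> T_le by (intro runs_train_round) auto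
    then have "runs orc train_round s' (30 * Suc \<kappa> * (T + 1)) (?I (Suc t))"
      by (rule runs_mono) (use \<open>t < T\<close> in simp_all)
    then show "holds (ILess 3 2) s' \<and> runs orc train_round s' (30 * Suc \<kappa> * (T + 1)) (?I (Suc t))"
      using I \<open>t < T\<close> by (simp add: layout_def)
  qed (simp_all add: layout_def)
  then show ?thesis
    by (rule runs_mono) (simp_all add: power2_eq_square algebra_simps)
qed

lemma runs_predict:
  assumes s: "layout s" "data T s" and x: "x \<in> extensional {..<n}"
  shows "runs orc predict_cmd (load_query n m x s) (30 * Suc \<kappa> * (T + 1))
    (\<lambda>s'. reg s' 0 = predictor T S x)"
proof -
  let ?I = "\<lambda>t s'. layout s' \<and> data T s' \<and> restrict (mem s' m) {..<n} = x \<and> idx s' 4 = t \<and>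
    reg s' 10 = score S t x \<and> reg s' 0 = u 0 + (\<Sum>i<t. u (score S i x)) \<and> reg s' 3 = real t + 1"
  have query: "restrict (\<lambda>j. if j < n then x j else mem s m j) {..<n} = x"
    using x by (auto simp: fun_eq_iff extensional_def)
  have 1: "runs orc (block [RConst 10 0, RConst 3 1, CallLink 0 10, IConst 4 0]) (load_query n m x s)
      (Suc (4 * Suc \<kappa>)) (?I 0)"
    using s T_le query
    by (intro runs_block) (auto simp: load_query_def layout_def data_def)
  have 2: "runs orc (While (ILess 4 2) (block (CallLink 11 10 # RAdd 0 0 11 # RAdd 3 3 4 # advance 1))) s'
      (Suc ((T - 0) * Suc (Suc (10 * Suc \<kappa>)))) (?I T)" if "?I 0 s'" for s'
  proof (rule runs_While[where I = ?I])
    show "?I 0 s'" by (rule that)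
    fix t s' assume I: "?I t s'" and "t < T"
    have "runs orc (block (CallLink 11 10 # RAdd 0 0 11 # RAdd 3 3 4 # advance 1)) s'
      (Suc (10 * Suc \<kappa>)) (?I (Suc t))"
      using I \<open>t < T\<close> T_le
      by (intro runs_block) (simp_all add: advance_def layout_def data_def score_Suc mult_ac)
    then show "holds (ILess 4 2) s' \<and>
      runs orc (block (CallLink 11 10 # RAdd 0 0 11 # RAdd 3 3 4 # advance 1)) s'
      (Suc (10 * Suc \<kappa>)) (?I (Suc t))"
      using I \<open>t < T\<close> by (simp add: layout_def)
  qed (simp_all add: layout_def)
  have 3: "runs orc (block [RDiv 0 0 3]) s' (Suc (Suc \<kappa>)) (\<lambda>s'. reg s' 0 = predictor T S x)"
    if "?I T s'" for s'
    using that by (intro runs_block) (simp_all add: predictor_def)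
  show ?thesis
    unfolding predict_cmd_def
    by (rule runs_mono[OF runs_Seq[OF 1 runs_Seq[OF 2 3]]]) (simp_all add: algebra_simps)
qed

end

text \<open>The parameters take linear time (30) and training quadratic time (40) in the numbers of
  doublings and rounds, whence 70; a prediction is linear and fits under the same bound.\<close>

lemma outputs_predictor:
  fixes K :: "vec \<Rightarrow> vec \<Rightarrow> real" and u n m \<kappa> B L \<epsilon> \<delta>
  assumes \<delta>: "0 < \<delta>" and X: "X \<subseteq> extensional {..<n}" and S: "\<And>i. i < m \<Longrightarrow> fst (S i) \<in> X"
  defines "N \<equiv> sample_budget B L \<epsilon> \<delta>"
  shows "outputs_hypothesis \<lparr>dim = n, kernel = K, link = u, kcost = \<kappa>\<rparr> train_cmd predict_cmd m X
    (initial_state n m B L \<epsilon> \<delta> S) (real (70 * Suc \<kappa> * (doublings \<delta> + N + 1)\<^sup>2))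
    (alphatron.predictor K u (learning_rate B L \<epsilon>) B (min m N) S)"
proof -
  interpret alphatron_machine K u "learning_rate B L \<epsilon>" B n m "min m N" \<kappa> S
    using X S by unfold_locales auto
  let ?c = "Suc \<kappa>" and ?k = "doublings \<delta>"
  have "runs orc train_cmd (initial_state n m B L \<epsilon> \<delta> S)
     (30 * ?c * (?k + N + 1) + 40 * ?c * (min m N + 1)\<^sup>2) (\<lambda>s. layout s \<and> data (min m N) s)"
    unfolding train_cmd_def
  proof (rule runs_Seq)
    show "runs orc choose_parameters (initial_state n m B L \<epsilon> \<delta> S) (30 * ?c * (?k + N + 1))
      (\<lambda>s. layout s \<and> data 0 s \<and> idx s 3 = 0 \<and> reg s 9 = 0)"
    proof (rule runs_mono[OF runs_choose_parameters[OF \<delta>, of _ n m B L \<epsilon> S]])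
      fix s :: ram_state
      assume "idx s 0 = n \<and> idx s 1 = m \<and> idx s 2 = min m (sample_budget B L \<epsilon> \<delta>) \<and> idx s 3 = 0 \<and>
        idx s 5 = Suc n \<and> idx s 6 = Suc (Suc n) \<and> reg s 4 = 1 \<and> reg s 8 = learning_rate B L \<epsilon> \<and>
        reg s 9 = 0 \<and> reg s 14 = B\<^sup>2 \<and> mem s = mem (initial_state n m B L \<epsilon> \<delta> S)"
      then show "layout s \<and> data 0 s \<and> idx s 3 = 0 \<and> reg s 9 = 0"
        using initial_data[of s B L \<epsilon> \<delta>] by (simp add: layout_def flip: N_def)
    qed (simp add: N_def)
  qed (elim conjE, rule runs_train_loop; assumption)
  moreover have bound: "30 * ?c * (?k + N + 1) + 40 * ?c * (min m N + 1)\<^sup>2 \<le> 70 * ?c * (?k + N + 1)\<^sup>2"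
  proof -
    have "(min m N + 1)\<^sup>2 \<le> (?k + N + 1)\<^sup>2" by (intro power_mono) auto
    moreover have "?k + N + 1 \<le> (?k + N + 1)\<^sup>2" by (simp add: power2_eq_square)
    moreover have "30 * a + 40 * b \<le> 70 * d" if "b \<le> d" "a \<le> d" for a b d :: nat
      using that by linarith
    ultimately have "?c * (30 * (?k + N + 1) + 40 * (min m N + 1)\<^sup>2) \<le> ?c * (70 * (?k + N + 1)\<^sup>2)"
      by (intro mult_le_mono2) blast
    then show ?thesis by (simp only: algebra_simps)
  qed
  ultimately obtain t s where train: "exec orc train_cmd (initial_state n m B L \<epsilon> \<delta> S) t s"
    "t \<le> 70 * ?c * (?k + N + 1)\<^sup>2" "layout s" "data (min m N) s"
    unfolding runs_def by (meson order_trans)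
  have "\<exists>t' s'. exec orc predict_cmd (load_query n m x s) t' s' \<and>
      t' \<le> 70 * ?c * (?k + N + 1)\<^sup>2 \<and> predictor (min m N) S x = reg s' 0" if "x \<in> X" for x
  proof -
    have "30 * ?c * (min m N + 1) \<le> 30 * ?c * (?k + N + 1)" by (intro mult_left_mono) auto
    then have le: "30 * ?c * (min m N + 1) \<le> 70 * ?c * (?k + N + 1)\<^sup>2" using bound by linarith
    have "x \<in> extensional {..<n}" using X that by blast
    from runs_predict[OF train(3,4) this] obtain t' s' where
      "exec orc predict_cmd (load_query n m x s) t' s'" "t' \<le> 30 * ?c * (min m N + 1)"
      "reg s' 0 = predictor (min m N) S x"
      unfolding runs_def by blast
    with le show ?thesis by (intro exI[of _ t'] exI[of _ s']) simp
  qed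
  then have "\<forall>x\<in>X. \<exists>t' s'. exec orc predict_cmd (load_query (dim orc) m x s) t' s' \<and>
      real t' \<le> real (70 * ?c * (?k + N + 1)\<^sup>2) \<and> predictor (min m N) S x = reg s' 0"
    unfolding of_nat_le_iff oracles.select_convs by blast
  then show ?thesis
    unfolding outputs_hypothesis_def using train(1,2)
    by (intro exI[of _ t] exI[of _ s] conjI) (simp_all only: of_nat_le_iff)
qed

section \<open>Sample size and running time\<close>

lemma ln_le_doublings:
  assumes "0 < \<delta>"
  shows "ln (1 / \<delta>) \<le> real (doublings \<delta>)"
proof -
  have "1 / \<delta> \<le> 2 ^ doublings \<delta>"
    using doublings(1)[OF assms] assms by (simp add: field_simps)
  then have "ln (1 / \<delta>) \<le> ln (2 ^ doublings \<delta>)"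
    using assms by (subst ln_le_cancel_iff) simp_all
  also have "\<dots> = real (doublings \<delta>) * ln 2" by (simp add: ln_realpow)
  also have "\<dots> \<le> real (doublings \<delta>) * 1"
    using ln_2_less_1 by (intro mult_left_mono) auto
  finally show ?thesis by simp
qed

text \<open>By minimality one doubling fewer leaves \<delta> below 1; the factor 2 is a bound for 1
  / ln 2.\<close>

lemma doublings_le:
  assumes "0 < \<delta>" "\<delta> \<le> 1"
  shows "real (doublings \<delta>) \<le> 2 * ln (1 / \<delta>) + 1"
proof (cases "doublings \<delta>")
  case 0
  then show ?thesis using assms by simp
next
  case (Suc k)
  then have "2 ^ k * \<delta> < 1" using doublings(2)[OF assms(1), of k] by simp
  then have "2 ^ k < 1 / \<delta>" using assms(1) by (simp add: field_simps)
  then have "ln (2 ^ k) < ln (1 / \<delta>)" using assms(1) by (subst ln_less_cancel_iff) simp_all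
  then have "real k * ln 2 < ln (1 / \<delta>)" by (simp add: ln_realpow)
  moreover have "real k * (1 / 2) \<le> real k * ln 2"
    using ln_ge_iff[of 2 "1 / 2"] exp_half_le2 by (intro mult_left_mono) simp_all
  ultimately show ?thesis using Suc by simp
qed

text \<open>Let Z be the base of the power on the right. It dominates every parameter, so (B L /
  \<epsilon>)^2 is at most Z^6 and the budget is of order Z^7. Doublings and budget plus 1 are at
  most 6 Z^7; squaring gives 36 Z^14, and 2520 = 70 * 36. The kernel cost adds the exponent
  d.\<close>

lemma running_time_le:
  fixes n :: nat and B L \<epsilon> \<delta> :: real
  assumes \<kappa>: "\<And>n. \<kappa> n \<le> c * (1 + n) ^ d"
    and "0 \<le> B" "0 < L" "0 < \<epsilon>" "0 < \<delta>" "\<delta> \<le> 1"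
  shows "real (70 * Suc (\<kappa> n) * (doublings \<delta> + sample_budget B L \<epsilon> \<delta> + 1)\<^sup>2) \<le>
    real (2520 * (1 + c)) * (1 + real n + B + L + 1 / \<epsilon> + ln (1 / \<delta>)) ^ (14 + d)"
proof -
  define Z where "Z = 1 + real n + B + L + 1 / \<epsilon> + ln (1 / \<delta>)"
  have ln: "0 \<le> ln (1 / \<delta>)" using assms by simp
  have inv: "0 < 1 / \<epsilon>" using assms by simp
  have Z: "1 \<le> Z" "B \<le> Z" "L \<le> Z" "1 / \<epsilon> \<le> Z" "1 + real n \<le> Z" "1 + ln (1 / \<delta>) \<le> Z"
    using assms ln inv unfolding Z_def by linarith+
  have Z7: "Z \<le> Z ^ 7" "1 \<le> Z ^ 7"
    using Z(1) power_increasing[of 1 7 Z] by simp_all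
  have k: "real (doublings \<delta>) \<le> 2 * Z"
    using doublings_le[of \<delta>] assms Z(6) by linarith
  have "B * L / \<epsilon> \<le> Z ^ 3"
  proof -
    have "B * L * (1 / \<epsilon>) \<le> Z * Z * Z"
      using Z inv assms by (intro mult_mono) auto
    then show ?thesis by (simp add: power3_eq_cube)
  qed
  moreover have "0 \<le> B * L / \<epsilon>" using assms by simp
  ultimately have "(B * L / \<epsilon>)\<^sup>2 \<le> (Z ^ 3)\<^sup>2" by (rule power_mono)
  then have "(B * L / \<epsilon>)\<^sup>2 * real (doublings \<delta>) \<le> (Z ^ 3)\<^sup>2 * (2 * Z)"
    using k by (intro mult_mono) auto
  also have "\<dots> = 2 * Z ^ 7" by (simp flip: power_mult power_Suc2)
  finally have "real (sample_budget B L \<epsilon> \<delta>) \<le> 2 * Z ^ 7 + 1"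
    using Z7 unfolding sample_budget_def by linarith
  then have "real (doublings \<delta> + sample_budget B L \<epsilon> \<delta> + 1) \<le> 6 * Z ^ 7"
    using k Z7 by simp
  then have "(real (doublings \<delta> + sample_budget B L \<epsilon> \<delta> + 1))\<^sup>2 \<le> (6 * Z ^ 7)\<^sup>2"
    by (intro power_mono) auto
  also have "\<dots> = 36 * Z ^ 14" by (simp add: power_mult_distrib flip: power_mult)
  finally have sq: "(real (doublings \<delta> + sample_budget B L \<epsilon> \<delta> + 1))\<^sup>2 \<le> 36 * Z ^ 14" .
  have "real (Suc (\<kappa> n)) \<le> (1 + real c) * Z ^ d"
  proof -
    have "real (\<kappa> n) \<le> real (c * (1 + n) ^ d)" using \<kappa>[of n] by (rule of_nat_mono)
    also have "\<dots> = real c * (1 + real n) ^ d" by simp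
    also have "\<dots> \<le> real c * Z ^ d" using Z(5) by (intro mult_left_mono power_mono) auto
    finally have "real (\<kappa> n) \<le> real c * Z ^ d" .
    moreover have "1 \<le> Z ^ d" using Z(1) by simp
    ultimately show ?thesis by (simp add: distrib_right)
  qed
  then have "70 * real (Suc (\<kappa> n)) * (real (doublings \<delta> + sample_budget B L \<epsilon> \<delta> + 1))\<^sup>2 \<le>
      70 * ((1 + real c) * Z ^ d) * (36 * Z ^ 14)"
    using sq Z(1) by (intro mult_mono) auto
  also have "\<dots> = 2520 * (1 + real c) * Z ^ (14 + d)" by (simp add: power_add mult_ac)
  finally show ?thesis by (simp add: Z_def)
qed

text \<open>The bound L \<epsilon> + \<epsilon> (8 + 2 / ln (1 / \<delta>)) becomes a multiple of L
  \<epsilon> by using L / \<open>L\<^sub>0\<close> >= 1 and monotonicity in \<delta>. So the factor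
  \<open>C\<close> depends on \<open>L\<^sub>0\<close> and \<open>\<delta>\<^sub>0\<close> alone,
  and is fixed before the kernel cost.\<close>

theorem theorem3:
  shows "\<exists>train predict :: cmd. \<exists>C :: real \<Rightarrow> real \<Rightarrow> real. \<forall>\<kappa>. poly_bounded \<kappa> \<longrightarrow>
    (\<exists>c k :: nat. \<forall>(n::nat) (X :: vec set) (D :: (vec \<times> real) measure)
        (u :: real \<Rightarrow> real) (f :: vec \<Rightarrow> real) (K :: vec \<Rightarrow> vec \<Rightarrow> real)
        (L::real) (B::real) (\<epsilon>::real) (\<delta>::real) (m::nat) (L\<^sub>0::real) (\<delta>\<^sub>0::real).
      X \<subseteq> ({..<n} \<rightarrow>\<^sub>E UNIV) \<longrightarrow>
      distribution_on n X D \<longrightarrow>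
      (AE z in D. cond_mean n X D z = u (f (fst z))) \<longrightarrow>
      (\<forall>z. u z \<in> {0..1}) \<longrightarrow> L-lipschitz_on UNIV u \<longrightarrow> mono u \<longrightarrow>
      uniformly_approximated X K \<epsilon> B f \<longrightarrow>
      (\<forall>x\<in>X. \<forall>x'\<in>X. K x x' \<le> 1) \<longrightarrow>
      case_prod K \<in> borel_measurable (domain_space n X \<Otimes>\<^sub>M domain_space n X) \<longrightarrow>
      0 < \<epsilon> \<longrightarrow> 0 < L\<^sub>0 \<longrightarrow> L\<^sub>0 \<le> L \<longrightarrow> 0 < \<delta> \<longrightarrow> \<delta> \<le> \<delta>\<^sub>0 \<longrightarrow> \<delta>\<^sub>0 < 1 \<longrightarrow>
      real m \<ge> (B * L / \<epsilon>)\<^sup>2 * ln (1 / \<delta>) \<longrightarrow>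
      (\<exists>h :: (nat \<Rightarrow> vec \<times> real) \<Rightarrow> vec \<Rightarrow> real.
        (\<forall>S \<in> space (Pi\<^sub>M {..<m} (\<lambda>_. D)).
           outputs_hypothesis \<lparr>dim = n, kernel = K, link = u, kcost = \<kappa> n\<rparr> train predict m X
             (initial_state n m B L \<epsilon> \<delta> S)
             (real c * (1 + real n + B + L + 1 / \<epsilon> + ln (1 / \<delta>)) ^ k) (h S)) \<and>
        measure (Pi\<^sub>M {..<m} (\<lambda>_. D))
          {S \<in> space (Pi\<^sub>M {..<m} (\<lambda>_. D)).
             h S \<in> borel_measurable (domain_space n X) \<and>
             err n X D (h S) \<le> ennreal (C L\<^sub>0 \<delta>\<^sub>0 * L * \<epsilon>)} \<ge> 1 - \<delta>))"
proof (rule exI[of _ train_cmd], rule exI[of _ predict_cmd],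
    rule exI[of _ "\<lambda>L\<^sub>0 \<delta>\<^sub>0. 1 + (8 + 2 / ln (1 / \<delta>\<^sub>0)) / L\<^sub>0"], intro allI impI)
  fix \<kappa> :: "nat \<Rightarrow> nat"
  assume "poly_bounded \<kappa>"
  then obtain c d where \<kappa>: "\<And>n. \<kappa> n \<le> c * (1 + n) ^ d"
    unfolding poly_bounded_def by blast
  show "\<exists>c k :: nat. \<forall>(n::nat) (X :: vec set) (D :: (vec \<times> real) measure)
        (u :: real \<Rightarrow> real) (f :: vec \<Rightarrow> real) (K :: vec \<Rightarrow> vec \<Rightarrow> real)
        (L::real) (B::real) (\<epsilon>::real) (\<delta>::real) (m::nat) (L\<^sub>0::real) (\<delta>\<^sub>0::real).
      X \<subseteq> ({..<n} \<rightarrow>\<^sub>E UNIV) \<longrightarrow>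
      distribution_on n X D \<longrightarrow>
      (AE z in D. cond_mean n X D z = u (f (fst z))) \<longrightarrow>
      (\<forall>z. u z \<in> {0..1}) \<longrightarrow> L-lipschitz_on UNIV u \<longrightarrow> mono u \<longrightarrow>
      uniformly_approximated X K \<epsilon> B f \<longrightarrow>
      (\<forall>x\<in>X. \<forall>x'\<in>X. K x x' \<le> 1) \<longrightarrow>
      case_prod K \<in> borel_measurable (domain_space n X \<Otimes>\<^sub>M domain_space n X) \<longrightarrow>
      0 < \<epsilon> \<longrightarrow> 0 < L\<^sub>0 \<longrightarrow> L\<^sub>0 \<le> L \<longrightarrow> 0 < \<delta> \<longrightarrow> \<delta> \<le> \<delta>\<^sub>0 \<longrightarrow> \<delta>\<^sub>0 < 1 \<longrightarrow>
      real m \<ge> (B * L / \<epsilon>)\<^sup>2 * ln (1 / \<delta>) \<longrightarrow>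
      (\<exists>h :: (nat \<Rightarrow> vec \<times> real) \<Rightarrow> vec \<Rightarrow> real.
        (\<forall>S \<in> space (Pi\<^sub>M {..<m} (\<lambda>_. D)).
           outputs_hypothesis \<lparr>dim = n, kernel = K, link = u, kcost = \<kappa> n\<rparr> train_cmd predict_cmd m X
             (initial_state n m B L \<epsilon> \<delta> S)
             (real c * (1 + real n + B + L + 1 / \<epsilon> + ln (1 / \<delta>)) ^ k) (h S)) \<and>
        measure (Pi\<^sub>M {..<m} (\<lambda>_. D))
          {S \<in> space (Pi\<^sub>M {..<m} (\<lambda>_. D)).
             h S \<in> borel_measurable (domain_space n X) \<and>
             err n X D (h S) \<le> ennreal ((1 + (8 + 2 / ln (1 / \<delta>\<^sub>0)) / L\<^sub>0) * L * \<epsilon>)} \<ge> 1 - \<delta>)"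
  proof (rule exI[of _ "2520 * (1 + c)"], rule exI[of _ "14 + d"], intro allI impI)
    fix n :: nat and X :: "vec set" and D :: "(vec \<times> real) measure" and u :: "real \<Rightarrow> real"
      and f :: "vec \<Rightarrow> real" and K :: "vec \<Rightarrow> vec \<Rightarrow> real" and L B \<epsilon> \<delta> :: real and m :: nat
      and L\<^sub>0 \<delta>\<^sub>0 :: real
    assume X: "X \<subseteq> ({..<n} \<rightarrow>\<^sub>E UNIV)" and D: "distribution_on n X D"
      and cm: "AE z in D. cond_mean n X D z = u (f (fst z))"
      and u: "\<forall>z. u z \<in> {0..1}" "L-lipschitz_on UNIV u" "mono u"
      and approx: "uniformly_approximated X K \<epsilon> B f"
      and K_le: "\<forall>x\<in>X. \<forall>x'\<in>X. K x x' \<le> 1"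
      and K_meas: "case_prod K \<in> borel_measurable (domain_space n X \<Otimes>\<^sub>M domain_space n X)"
      and pos: "0 < \<epsilon>" "0 < L\<^sub>0" "L\<^sub>0 \<le> L" "0 < \<delta>" "\<delta> \<le> \<delta>\<^sub>0" "\<delta>\<^sub>0 < 1"
      and m: "(B * L / \<epsilon>)\<^sup>2 * ln (1 / \<delta>) \<le> real m"
    define \<rho> where "\<rho> = ln (1 / \<delta>)"
    define N where "N = sample_budget B L \<epsilon> \<delta>"
    define T where "T = min m N"
    define P where "P = Pi\<^sub>M {..<m} (\<lambda>_. D)"
    define h where "h = alphatron.predictor K u (learning_rate B L \<epsilon>) B T"
    have L: "0 < L" and \<rho>: "0 < \<rho>" "exp (- \<rho>) = \<delta>"
      using pos by (auto simp: \<rho>_def ln_div exp_minus)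
    from approx obtain H ip v where rkhs: "is_rkhs X K H ip" and v: "v \<in> H" "sqrt (ip v v) \<le> B"
      "\<And>x. x \<in> X \<Longrightarrow> \<bar>f x - ip v (canonical_feature X K x)\<bar> \<le> \<epsilon>"
      unfolding uniformly_approximated_def by blast
    interpret rkhs X K H ip by unfold_locales (rule rkhs)
    have "0 \<le> sqrt (ip v v)" using ip_nonneg[OF v(1)] by simp
    then have B: "0 \<le> B" "ip v v \<le> B\<^sup>2"
      using order_trans[OF _ v(2)] sqrt_le_D[OF v(2)] by blast+
    have rate: "0 \<le> learning_rate B L \<epsilon>" "learning_rate B L \<epsilon> \<le> B"
      using B L pos by (simp_all add: learning_rate_def divide_le_eq add_pos_nonneg algebra_simps)
    \<comment> \<open>Both arguments of the minimum \<open>T\<close> are large enough: m by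
      hypothesis, the budget because \<open>doublings\<close> dominates the logarithm.\<close>
    have T_ge: "(B * L)\<^sup>2 * \<rho> \<le> \<epsilon>\<^sup>2 * real T"
    proof -
      have "(B * L / \<epsilon>)\<^sup>2 * \<rho> \<le> (B * L / \<epsilon>)\<^sup>2 * real (doublings \<delta>)"
        using ln_le_doublings[OF pos(4)] by (intro mult_left_mono) (auto simp: \<rho>_def)
      also have "\<dots> \<le> real N" unfolding N_def sample_budget_def by linarith
      finally have "(B * L / \<epsilon>)\<^sup>2 * \<rho> \<le> real T" using m by (simp add: T_def \<rho>_def)
      then show ?thesis using pos(1) by (simp add: power_divide field_simps)
    qed
    have B_pos: "0 < B" if "0 < T"
    proof (rule ccontr)
      assume "\<not> 0 < B"
      then have "B = 0" using B by simp
      then show False using that by (simp add: T_def N_def sample_budget_def)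
    qed
    interpret tuned_learning X K H ip u "learning_rate B L \<epsilon>" B v n D f L \<epsilon> m T \<rho>
      using X D cm u v K_le K_meas pos L \<rho> B rate T_ge B_pos
      by unfold_locales (auto simp: reproducing T_def)
    have time: "outputs_hypothesis \<lparr>dim = n, kernel = K, link = u, kcost = \<kappa> n\<rparr> train_cmd predict_cmd m X
        (initial_state n m B L \<epsilon> \<delta> S)
        (real (2520 * (1 + c)) * (1 + real n + B + L + 1 / \<epsilon> + ln (1 / \<delta>)) ^ (14 + d)) (h S)"
      if "S \<in> space P" for S
    proof -
      have S: "fst (S i) \<in> X" if "i < m" for i
        using sample_in[of S m i] \<open>S \<in> space P\<close> that by (simp add: P_def)
      have X': "X \<subseteq> extensional {..<n}" using X by (auto simp: PiE_def)
      have *: "real (70 * Suc (\<kappa> n) * (doublings \<delta> + N + 1)\<^sup>2) \<le>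
        real (2520 * (1 + c)) * (1 + real n + B + L + 1 / \<epsilon> + ln (1 / \<delta>)) ^ (14 + d)"
        unfolding N_def using running_time_le[OF \<kappa>, of B L \<epsilon> \<delta> n] B L pos by simp
      from outputs_predictor[OF pos(4) X' S, where K = K and u = u and \<kappa> = "\<kappa> n" and B = B and L = L and \<epsilon> = \<epsilon>]
      show ?thesis
        unfolding outputs_hypothesis_def h_def T_def N_def[symmetric] using * by (meson order_trans)
    qed
    have "L * \<epsilon> + \<epsilon> * (8 + 2 / \<rho>) \<le> (1 + (8 + 2 / ln (1 / \<delta>\<^sub>0)) / L\<^sub>0) * L * \<epsilon>"
    proof -
      have \<rho>0: "0 < ln (1 / \<delta>\<^sub>0)" using pos by simp
      have "ln (1 / \<delta>\<^sub>0) \<le> \<rho>" unfolding \<rho>_def using pos by (simp add: ln_div)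
      then have "2 / \<rho> \<le> 2 / ln (1 / \<delta>\<^sub>0)" using \<rho>0 by (intro divide_left_mono) auto
      moreover have "8 + 2 / ln (1 / \<delta>\<^sub>0) \<le> (8 + 2 / ln (1 / \<delta>\<^sub>0)) * (L / L\<^sub>0)"
        using mult_left_mono[of 1 "L / L\<^sub>0" "8 + 2 / ln (1 / \<delta>\<^sub>0)"] pos \<rho>0 by simp
      ultimately have "8 + 2 / \<rho> \<le> (8 + 2 / ln (1 / \<delta>\<^sub>0)) * (L / L\<^sub>0)" by linarith
      then have "\<epsilon> * (8 + 2 / \<rho>) \<le> \<epsilon> * ((8 + 2 / ln (1 / \<delta>\<^sub>0)) * (L / L\<^sub>0))"
        using pos by (intro mult_left_mono) auto
      moreover have "(1 + a / L\<^sub>0) * L * \<epsilon> = L * \<epsilon> + \<epsilon> * (a * (L / L\<^sub>0))" for a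
        by (simp add: distrib_right)
      ultimately show ?thesis by simp
    qed
    from good_sample[OF this] have good: "1 - \<delta> \<le> measure P {S \<in> space P.
        h S \<in> borel_measurable (domain_space n X) \<and>
        err n X D (h S) \<le> ennreal ((1 + (8 + 2 / ln (1 / \<delta>\<^sub>0)) / L\<^sub>0) * L * \<epsilon>)}"
      by (simp add: P_def h_def \<rho>(2))
    show "\<exists>h :: (nat \<Rightarrow> vec \<times> real) \<Rightarrow> vec \<Rightarrow> real.
        (\<forall>S \<in> space (Pi\<^sub>M {..<m} (\<lambda>_. D)).
           outputs_hypothesis \<lparr>dim = n, kernel = K, link = u, kcost = \<kappa> n\<rparr> train_cmd predict_cmd m X
             (initial_state n m B L \<epsilon> \<delta> S)
             (real (2520 * (1 + c)) * (1 + real n + B + L + 1 / \<epsilon> + ln (1 / \<delta>)) ^ (14 + d)) (h S)) \<and>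
        measure (Pi\<^sub>M {..<m} (\<lambda>_. D))
          {S \<in> space (Pi\<^sub>M {..<m} (\<lambda>_. D)).
             h S \<in> borel_measurable (domain_space n X) \<and>
             err n X D (h S) \<le> ennreal ((1 + (8 + 2 / ln (1 / \<delta>\<^sub>0)) / L\<^sub>0) * L * \<epsilon>)} \<ge> 1 - \<delta>"
      using time good unfolding P_def by (intro exI[of _ h]) blast
  qed
qed

end
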